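(* Let $\Omega\subset\mathbb C^n$ be a bounded domain and $p>0$. For every $z\in\Omega$ and every $X\in\mathbb C^n$, $$i\partial\bar\partial\log K_p(z;X)\ \ge\ \begin{cases} B_p(z;X)^2 & \text{for } p\ge2,\\ C(z;X)^2 & \text{for } p\le2.\end{cases}$$
   Context: For $p>0$, $A^p(\Omega)$ is the space of holomorphic functions $f$ on $\Omega$ with $\|f\|_p^p:=\int_\Omega|f|^p<\infty$ (Lebesgue measure); $A^\infty(\Omega)$ is the space of bounded holomorphic functions with the sup norm $\|\cdot\|_\infty$. Put $m_p(z):=\inf\{\|f\|_p: f\in A^p(\Omega),\ f(z)=1\}$ and $K_p(z):=m_p(z)^{-p}$. Identify $X=\sum_jX_j\,\partial/\partial z_j$ with $(X_1,\dots,X_n)\in\mathbb C^n$ and write $Xf=\sum_jX_j\,\partial f/\partial z_j$. The $p$-Bergman metric is $B_p(z;X):=K_p(z)^{-1/p}\cdot\sup\{|Xf(z)|: f\in A^p(\Omega),\ f(z)=0,\ \|f\|_p=1\}$, and the Carathéodory metric is $C(z;X):=\sup\{|Xf(z)|: f\in A^\infty(\Omega),\ f(z)=0,\ \|f\|_\infty=1\}$. For a real-valued upper semicontinuous function $u$ on $\Omega$, the generalized Levi form is $$i\partial\bar\partial u(z;X):=\liminf_{r\to0+}\frac1{r^2}\left\{\frac1{2\pi}\int_0^{2\pi}u(z+re^{i\theta}X)\,d\theta-u(z)\right\}.$$ *)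

theory Defs
  imports "HOL-Analysis.Analysis"
begin

text \<open>
  Functions on a domain \<open>\<Omega>\<close> in \<open>\<complex>\<^sup>n\<close> are total functions on \<^typ>\<open>complex ^ 'n\<close>; every notion
  below depends only on their values on \<open>\<Omega>\<close>, provided \<open>\<Omega>\<close> is open and \<open>z \<in> \<Omega>\<close>.
\<close>

definition holomorphic_cvec_on :: "(complex ^ 'n \<Rightarrow> complex) \<Rightarrow> (complex ^ 'n) set \<Rightarrow> bool" where
  "holomorphic_cvec_on f \<Omega> \<longleftrightarrow>
    (\<forall>z\<in>\<Omega>. \<exists>D. (f has_derivative D) (at z) \<and> (\<forall>c v. D (c *s v) = c * D v))"

definition Ap_norm :: "real \<Rightarrow> (complex ^ 'n) set \<Rightarrow> (complex ^ 'n \<Rightarrow> complex) \<Rightarrow> real" where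
  "Ap_norm p \<Omega> f = (LINT x:\<Omega>|lebesgue. norm (f x) powr p) powr (1 / p)"

definition Ap :: "real \<Rightarrow> (complex ^ 'n) set \<Rightarrow> (complex ^ 'n \<Rightarrow> complex) set" where
  "Ap p \<Omega> = {f. holomorphic_cvec_on f \<Omega> \<and> set_integrable lebesgue \<Omega> (\<lambda>x. norm (f x) powr p)}"

definition Ainf_norm :: "(complex ^ 'n) set \<Rightarrow> (complex ^ 'n \<Rightarrow> complex) \<Rightarrow> real" where
  "Ainf_norm \<Omega> f = (SUP x\<in>\<Omega>. norm (f x))"

definition Ainf :: "(complex ^ 'n) set \<Rightarrow> (complex ^ 'n \<Rightarrow> complex) set" where
  "Ainf \<Omega> = {f. holomorphic_cvec_on f \<Omega> \<and> bounded (f ` \<Omega>)}"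

text \<open>
  The infima and suprema below are taken in \<^typ>\<open>real\<close>. For a bounded domain \<open>\<Omega>\<close>, \<open>p > 0\<close> and
  \<open>z \<in> \<Omega>\<close> the sets involved are nonempty (they contain a constant, respectively a normalized affine
  function vanishing at \<open>z\<close>) and bounded (by the mean value inequality and Cauchy's estimate), so
  these are the usual infima and suprema; moreover \<open>m\<^sub>p(z) > 0\<close>.
\<close>

definition m_p :: "real \<Rightarrow> (complex ^ 'n) set \<Rightarrow> complex ^ 'n \<Rightarrow> real" where
  "m_p p \<Omega> z = Inf {Ap_norm p \<Omega> f | f. f \<in> Ap p \<Omega> \<and> f z = 1}"

definition K_p :: "real \<Rightarrow> (complex ^ 'n) set \<Rightarrow> complex ^ 'n \<Rightarrow> real" where
  "K_p p \<Omega> z = m_p p \<Omega> z powr (- p)"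

definition complex_partial :: "'n \<Rightarrow> (complex ^ 'n \<Rightarrow> complex) \<Rightarrow> complex ^ 'n \<Rightarrow> complex" where
  "complex_partial j f z = deriv (\<lambda>w. f (z + axis j w)) 0"

definition vec_deriv :: "complex ^ 'n \<Rightarrow> (complex ^ 'n \<Rightarrow> complex) \<Rightarrow> complex ^ 'n \<Rightarrow> complex" where
  "vec_deriv X f z = (\<Sum>j\<in>UNIV. X $ j * complex_partial j f z)"

definition bergman_metric ::
    "real \<Rightarrow> (complex ^ 'n) set \<Rightarrow> complex ^ 'n \<Rightarrow> complex ^ 'n \<Rightarrow> real" where
  "bergman_metric p \<Omega> z X =
    K_p p \<Omega> z powr (- 1 / p) *
    Sup {norm (vec_deriv X f z) | f. f \<in> Ap p \<Omega> \<and> f z = 0 \<and> Ap_norm p \<Omega> f = 1}"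

definition caratheodory_metric ::
    "(complex ^ 'n) set \<Rightarrow> complex ^ 'n \<Rightarrow> complex ^ 'n \<Rightarrow> real" where
  "caratheodory_metric \<Omega> z X =
    Sup {norm (vec_deriv X f z) | f. f \<in> Ainf \<Omega> \<and> f z = 0 \<and> Ainf_norm \<Omega> f = 1}"

text \<open>
  The lower limit is taken in \<^typ>\<open>ereal\<close>, since it may be infinite. Only small \<open>r\<close> matter, so the
  circles lie in the open set on which \<open>u\<close> is considered. The mean over the circle is a real
  Lebesgue integral, hence meaningful for \<open>u\<close> integrable over small circles; this covers
  \<open>u = log K\<^sub>p\<close>, which is continuous on \<open>\<Omega>\<close>.
\<close>

definition levi_form :: "(complex ^ 'n \<Rightarrow> real) \<Rightarrow> complex ^ 'n \<Rightarrow> complex ^ 'n \<Rightarrow> ereal" where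
  "levi_form u z X =
    Liminf (at_right 0) (\<lambda>r::real. ereal
      (1 / r\<^sup>2 * (1 / (2 * pi) * (LINT \<theta>:{0..2 * pi}|lborel. u (z + (of_real r * cis \<theta>) *s X)) - u z)))"

end

theory Submission
  imports Defs "HOL-Complex_Analysis.Complex_Analysis" "HOL-Real_Asymp.Real_Asymp"
begin

text \<open>
  The proof perturbs a minimiser against the direction of the point. Let \<open>f\<close>, with \<open>f z = 1\<close>, be a minimiser for
  \<open>m_p\<close> at \<open>z\<close>, put \<open>N = \<integral>|f| powr p\<close>, so that \<open>ln K_p = - ln N\<close> at \<open>z\<close>, and let \<open>\<psi>\<close> be in \<open>A\<^sup>p\<close> with
  \<open>\<psi> z = 0\<close> and \<open>X\<close>-derivative \<open>b\<close> at \<open>z\<close>. At the point \<open>w = z + (r * cis t) *s X\<close> test \<open>K_p\<close> with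
  \<open>g = f + cis (- t) * r * \<psi>\<close>:
  \<open>ln K_p \<ge> p * ln |g w| - ln (\<integral>|g| powr p)\<close>, and average over \<open>t\<close>.

  As a function of \<open>l = r * cis t\<close>, the value \<open>g w\<close> agrees on the circle with \<open>f + r\<^sup>2 * \<psi> / l\<close>, which is
  holomorphic in the disc because \<open>\<psi>\<close> vanishes at the centre. Near \<open>z\<close> it has no zeros, so the mean of
  its log-modulus is \<open>ln |1 + r\<^sup>2 * b|\<close>. The mass of \<open>g\<close> grows on average only by second order terms,
  because the circle mean of \<open>|1 + cis (- t) * v| powr p\<close> is \<open>1 + p\<^sup>2 / 4 * |v|\<^sup>2 + o(|v|\<^sup>2)\<close>. If the average
  of the mass is \<open>N * (1 + \<kappa> * r\<^sup>2 + o(r\<^sup>2))\<close>, then the Levi form is at least \<open>p * Re b - \<kappa>\<close>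
  (\<open>levi_form_ln_K_p_ge\<close>).

  For a bounded \<open>h\<close> with \<open>|h| \<le> 1\<close> take \<open>\<psi> = a * f * h\<close>, with \<open>\<kappa> = p\<^sup>2 / 4 * |a|\<^sup>2\<close>; optimising over \<open>a\<close>
  gives \<open>|Xh|\<^sup>2\<close> (\<open>norm_square_le_levi_form_bounded\<close>). For \<open>p \<ge> 2\<close> and \<open>\<phi>\<close> of norm 1 in \<open>A\<^sup>p\<close> take
  \<open>\<psi> = a * \<phi>\<close>; Hoelder's inequality for \<open>|f| powr (p - 2) * |\<phi>|\<^sup>2\<close> gives
  \<open>\<kappa> = p\<^sup>2 / 4 * |a|\<^sup>2 / m_p\<^sup>2\<close>, and optimising gives \<open>m_p\<^sup>2 * |X\<phi>|\<^sup>2\<close> (\<open>norm_square_le_levi_form_Ap\<close>).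

  In the proof \<open>f\<close> varies with \<open>r\<close> and is a near-minimiser, with mass at most \<open>N * (1 + \<epsilon> * r\<^sup>2)\<close>. The
  estimates then require bounds near \<open>z\<close> that are uniform in \<open>r\<close>. They come from the boundedness of
  point evaluations on \<open>A\<^sup>p\<close> (\<open>Ap_point_evaluation\<close>), which also yields \<open>m_p > 0\<close>. It rests on the mean
  value inequality for \<open>|f|\<close> on balls, obtained from the one-variable mean value property on complex
  lines and the rotation invariance of Lebesgue measure.
\<close>

section \<open>Invariance of Lebesgue measure under linear isometries\<close>

lemma nn_integral_lborel_translate:
  fixes g :: "'a::euclidean_space \<Rightarrow> ennreal"
  assumes [measurable]: "g \<in> borel_measurable borel"
  shows "(\<integral>\<^sup>+y. g (c + y) \<partial>lborel) = (\<integral>\<^sup>+y. g y \<partial>lborel)"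
proof -
  have "(\<integral>\<^sup>+y. g y \<partial>lborel) = (\<integral>\<^sup>+y. g y \<partial>distr lborel borel ((+) c))"
    by (simp add: lborel_distr_plus)
  also have "\<dots> = (\<integral>\<^sup>+y. g (c + y) \<partial>lborel)"
    by (subst nn_integral_distr) auto
  finally show ?thesis by simp
qed

lemma nn_integral_lborel_reflect:
  fixes g :: "'a::euclidean_space \<Rightarrow> ennreal"
  assumes [measurable]: "g \<in> borel_measurable borel"
  shows "(\<integral>\<^sup>+y. g (c - y) \<partial>lborel) = (\<integral>\<^sup>+y. g y \<partial>lborel)"
proof -
  have "(\<integral>\<^sup>+y. g y \<partial>lborel) = (\<integral>\<^sup>+y. g y \<partial>distr lborel borel (\<lambda>y. c + (-1) *\<^sub>R y))"
    by (subst lborel_affine[of "-1" c]) (auto simp: density_1)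
  also have "\<dots> = (\<integral>\<^sup>+y. g (c - y) \<partial>lborel)"
    by (subst nn_integral_distr) auto
  finally show ?thesis by simp
qed

text \<open>
  Lebesgue measure is the only translation invariant measure up to a factor, and a linear isometry
  maps the unit ball onto itself, so the factor is 1. The uniqueness argument is carried out inside
  the proof with Fubini's theorem, with the unit ball as the reference set.
\<close>

lemma lborel_distr_linear_isometry:
  fixes T :: "'a::euclidean_space \<Rightarrow> 'a"
  assumes lin: "linear T" and iso: "\<And>x. norm (T x) = norm x"
  shows "distr lborel borel T = lborel"
proof (rule measure_eqI)
  show "sets (distr lborel borel T) = sets lborel" by simp
next
  fix A assume "A \<in> sets (distr lborel borel T)"
  then have A[measurable]: "A \<in> sets borel" by simp
  have T[measurable]: "T \<in> borel_measurable borel"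
    using lin by (intro borel_measurable_continuous_onI linear_continuous_on linear_conv_bounded_linear[THEN iffD1])
  have inj: "inj T"
    unfolding linear_injective_0[OF lin] using iso by (metis norm_eq_zero)
  have surj: "surj T"
    using lin inj by (rule linear_injective_imp_surjective) (rule refl)
  define B where "B = ball (0::'a) 1"
  have B_meas[measurable]: "B \<in> sets borel" by (simp add: B_def)
  let ?l = "\<lambda>S. emeasure lborel S"
  let ?I = "\<lambda>S x. indicator S x :: ennreal"
  have TB: "(\<integral>\<^sup>+x. ?I B (T x) \<partial>lborel) = ?l B"
  proof -
    have "?I B (T x) = ?I B x" for x
      by (auto simp: indicator_def iso B_def)
    then show ?thesis by simp
  qed
  \<comment> \<open>Both the image measure \<open>S \<mapsto> |{x. T x \<in> S}|\<close> and Lebesgue measure are translation invariant;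
    Fubini then gives \<open>|{x. T x \<in> A}| |B| = |A| |{x. T x \<in> B}|\<close>, and \<open>T\<close> preserves the ball \<open>B\<close>.\<close>
  have "(\<integral>\<^sup>+x. ?I A (T x) \<partial>lborel) * ?l B = (\<integral>\<^sup>+x. ?I A (T x) * (\<integral>\<^sup>+y. ?I B (T x + y) \<partial>lborel) \<partial>lborel)"
    by (simp add: nn_integral_lborel_translate[where g = "indicator B"] nn_integral_multc)
  also have "\<dots> = (\<integral>\<^sup>+x. (\<integral>\<^sup>+y. ?I A (T x) * ?I B (T x + y) \<partial>lborel) \<partial>lborel)"
    by (intro nn_integral_cong nn_integral_cmult[symmetric]) measurable
  also have "\<dots> = (\<integral>\<^sup>+y. (\<integral>\<^sup>+x. ?I A (T x) * ?I B (T x + y) \<partial>lborel) \<partial>lborel)"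
    by (rule lborel_pair.Fubini'[symmetric]) measurable
  also have "\<dots> = (\<integral>\<^sup>+y. (\<integral>\<^sup>+x. ?I A (T x - y) * ?I B (T x) \<partial>lborel) \<partial>lborel)"
  proof (rule nn_integral_cong)
    fix y :: 'a
    obtain u where u: "T u = y" using surj by (metis surjD)
    have "(\<integral>\<^sup>+x. ?I A (T x) * ?I B (T x + y) \<partial>lborel)
        = (\<integral>\<^sup>+x. ?I A (T (- u + x)) * ?I B (T (- u + x) + y) \<partial>lborel)"
      by (rule nn_integral_lborel_translate[symmetric, where c = "-u"]) measurable
    also have "\<dots> = (\<integral>\<^sup>+x. ?I A (T x - y) * ?I B (T x) \<partial>lborel)"
      using u by (simp add: linear_diff[OF lin])
    finally show "(\<integral>\<^sup>+x. ?I A (T x) * ?I B (T x + y) \<partial>lborel) = \<dots>" .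
  qed
  also have "\<dots> = (\<integral>\<^sup>+x. (\<integral>\<^sup>+y. ?I A (T x - y) * ?I B (T x) \<partial>lborel) \<partial>lborel)"
    by (rule lborel_pair.Fubini') measurable
  also have "\<dots> = (\<integral>\<^sup>+x. ?l A * ?I B (T x) \<partial>lborel)"
    by (subst nn_integral_multc) (auto simp: nn_integral_lborel_reflect[where g = "indicator A"])
  also have "\<dots> = ?l A * ?l B"
    by (subst nn_integral_cmult) (auto simp: TB)
  finally have eq: "(\<integral>\<^sup>+x. ?I A (T x) \<partial>lborel) * ?l B = ?l A * ?l B" .
  have B_emeasure: "?l B \<noteq> 0" "?l B \<noteq> \<infinity>"
    using emeasure_lborel_ball_finite[of "0::'a" 1] content_ball_pos[of 1 "0::'a"]
    by (auto simp: measure_def B_def)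
  have "(\<integral>\<^sup>+x. ?I A (T x) \<partial>lborel) = ?l A"
    using eq B_emeasure by (simp add: mult.commute[of _ "emeasure lborel B"] ennreal_mult_cancel_left)
  moreover have "emeasure (distr lborel borel T) A = (\<integral>\<^sup>+x. ?I A (T x) \<partial>lborel)"
    by (simp flip: nn_integral_indicator add: nn_integral_distr)
  ultimately show "emeasure (distr lborel borel T) A = emeasure lborel A" by simp
qed

section \<open>Restriction to complex lines\<close>

lemma norm_vector_smult: "norm (c *s v) = norm c * norm (v :: complex ^ 'n)"
  by (simp add: norm_vec_def L2_set_right_distrib norm_mult)

lemma bounded_linear_smult_left: "bounded_linear (\<lambda>c. c *s (v :: complex ^ 'n))"
  unfolding linear_conv_bounded_linear [symmetric]
  by (intro linearI) (auto simp: vec_eq_iff algebra_simps)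

lemma bounded_linear_smult_right: "bounded_linear (\<lambda>v :: complex ^ 'n. c *s v)"
  unfolding linear_conv_bounded_linear [symmetric]
  by (intro linearI) (auto simp: vec_eq_iff algebra_simps)

lemma continuous_on_smult [continuous_intros]:
  fixes g :: "'a::topological_space \<Rightarrow> complex ^ 'n"
  assumes "continuous_on S f" "continuous_on S g"
  shows "continuous_on S (\<lambda>x. f x *s g x)"
  unfolding vector_scalar_mult_def
  by (intro continuous_intros assms continuous_on_vec_lambda)

lemma nn_integral_lborel_rotate:
  fixes g :: "complex ^ 'n \<Rightarrow> ennreal"
  assumes [measurable]: "g \<in> borel_measurable borel" and c: "norm c = 1"
  shows "(\<integral>\<^sup>+v. g (c *s v) \<partial>lborel) = (\<integral>\<^sup>+v. g v \<partial>lborel)"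
proof -
  have m[measurable]: "(\<lambda>v::complex^'n. c *s v) \<in> borel_measurable borel"
    by (intro borel_measurable_continuous_onI continuous_intros)
  have "(\<integral>\<^sup>+v. g v \<partial>lborel) = (\<integral>\<^sup>+v. g v \<partial>distr lborel borel (\<lambda>v. c *s v))"
    using bounded_linear_smult_right[of c]
    by (subst lborel_distr_linear_isometry)
       (auto simp: linear_conv_bounded_linear norm_vector_smult c)
  also have "\<dots> = (\<integral>\<^sup>+v. g (c *s v) \<partial>lborel)"
    by (subst nn_integral_distr) auto
  finally show ?thesis by simp
qed

lemma holomorphic_cvec_on_subset:
  "holomorphic_cvec_on f \<Omega> \<Longrightarrow> S \<subseteq> \<Omega> \<Longrightarrow> holomorphic_cvec_on f S"
  by (auto simp: holomorphic_cvec_on_def)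

lemma holomorphic_cvec_on_imp_continuous_on:
  "holomorphic_cvec_on f \<Omega> \<Longrightarrow> continuous_on \<Omega> f"
  unfolding holomorphic_cvec_on_def
  by (meson continuous_at_imp_continuous_on has_derivative_continuous)

lemma has_field_derivative_along_line:
  fixes l :: complex
  assumes "(f has_derivative D) (at (w + l *s v))" and "\<And>c v. D (c *s v) = c * D v"
  shows "((\<lambda>l. f (w + l *s v)) has_field_derivative D v) (at l)"
proof -
  have "((\<lambda>l. w + l *s v) has_derivative (\<lambda>h. h *s v)) (at l)"
    using bounded_linear.has_derivative[OF bounded_linear_smult_left, of "\<lambda>l. l" "\<lambda>l. l" "at l" v]
    by (auto intro!: derivative_eq_intros)
  then have "((\<lambda>l. f (w + l *s v)) has_derivative (\<lambda>h. D (h *s v))) (at l)"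
    using assms(1) by (rule has_derivative_compose)
  then show ?thesis
    by (simp add: has_field_derivative_def assms(2) mult.commute[of _ "D v"])
qed

lemma holomorphic_on_line:
  assumes "holomorphic_cvec_on f \<Omega>" and "\<And>l. l \<in> S \<Longrightarrow> w + l *s v \<in> \<Omega>"
  shows "(\<lambda>l. f (w + l *s v)) holomorphic_on S"
proof (rule holomorphic_onI)
  fix l assume "l \<in> S"
  then obtain D where "(f has_derivative D) (at (w + l *s v))" "\<And>c v. D (c *s v) = c * D v"
    using assms unfolding holomorphic_cvec_on_def by meson
  then have "((\<lambda>l. f (w + l *s v)) has_field_derivative D v) (at l)"
    by (rule has_field_derivative_along_line)
  then show "(\<lambda>l. f (w + l *s v)) field_differentiable at l within S"
    using field_differentiable_at_within field_differentiable_def by blast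
qed

lemma vec_deriv_eq_deriv_line:
  assumes "holomorphic_cvec_on f \<Omega>" and "z \<in> \<Omega>"
  shows "vec_deriv X f z = deriv (\<lambda>l. f (z + l *s X)) 0"
proof -
  obtain D where D: "(f has_derivative D) (at z)" "\<And>c v. D (c *s v) = c * D v"
    using assms unfolding holomorphic_cvec_on_def by meson
  have line: "deriv (\<lambda>l. f (z + l *s v)) 0 = D v" for v
    using D by (intro DERIV_imp_deriv has_field_derivative_along_line) auto
  have axis: "axis j l = l *s axis j 1" for j :: 'a and l :: complex
    by (simp add: vec_eq_iff axis_def)
  have "complex_partial j f z = D (axis j 1)" for j
    unfolding complex_partial_def by (subst axis) (rule line)
  moreover have "D X = (\<Sum>j\<in>UNIV. X $ j * D (axis j 1))"
  proof -
    have "D X = D (\<Sum>j\<in>UNIV. X $ j *s axis j 1)"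
      by (simp add: basis_expansion)
    also have "\<dots> = (\<Sum>j\<in>UNIV. X $ j * D (axis j 1))"
      using D(1) by (simp add: linear_sum[OF has_derivative_linear] D(2))
    finally show ?thesis .
  qed
  ultimately show ?thesis
    by (simp add: vec_deriv_def line)
qed

text \<open>
  Cauchy's integral formula at the centre of a disc, written as a Lebesgue integral over the angle.
\<close>

lemma circle_mean_value:
  assumes G: "G holomorphic_on cball 0 r" and r: "r > 0"
  shows "set_integrable lborel {0..2 * pi} (\<lambda>t. G (of_real r * cis t))"
    and "(LINT t:{0..2 * pi}|lborel. G (of_real r * cis t)) = of_real (2 * pi) * G 0"
proof -
  have cont: "continuous_on {0..2 * pi} (\<lambda>t. G (of_real r * cis t))"
    using r by (intro continuous_on_compose2[OF holomorphic_on_imp_continuous_on[OF G]]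
        continuous_intros) (auto simp: norm_mult)
  then show int: "set_integrable lborel {0..2 * pi} (\<lambda>t. G (of_real r * cis t))"
    unfolding set_integrable_def by (intro borel_integrable_compact) auto
  have "((\<lambda>u. G u / (u - 0)) has_contour_integral (2 * of_real pi * \<i> * G 0)) (circlepath 0 r)"
    using G r by (intro Cauchy_integral_circlepath_simple) auto
  then have "((\<lambda>t. G (0 + r * cis t) / (0 + r * cis t - 0) * r * \<i> * cis t) has_integral
      2 * of_real pi * \<i> * G 0) {0..2 * pi}"
    unfolding circlepath_def by (subst (asm) has_contour_integral_part_circlepath_iff) auto
  also have "(\<lambda>t. G (0 + r * cis t) / (0 + r * cis t - 0) * r * \<i> * cis t) = (\<lambda>t. \<i> * G (r * cis t))"
    using r by (auto simp: field_simps)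
  finally have "((\<lambda>t. - \<i> * (\<i> * G (r * cis t))) has_integral (- \<i> * (2 * of_real pi * \<i> * G 0))) {0..2 * pi}"
    by (rule has_integral_mult_right)
  then have "((\<lambda>t. G (r * cis t)) has_integral (of_real (2 * pi) * G 0)) {0..2 * pi}"
    by (simp add: algebra_simps)
  then show "(LINT t:{0..2 * pi}|lborel. G (of_real r * cis t)) = of_real (2 * pi) * G 0"
    using set_borel_integral_eq_integral(2)[OF int] by (simp add: integral_unique)
qed

text \<open>
  Along each direction \<open>v\<close> the function is holomorphic in one variable, so \<open>|f w|\<close> is at most the mean
  of \<open>|f|\<close> over the circle \<open>w + cis t *s v\<close>. Integrating over \<open>v\<close> in a ball and exchanging the integrals,
  each rotation by \<open>cis t\<close> drops out, since it preserves the ball and Lebesgue measure.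
\<close>

lemma norm_center_le_ball_integral:
  fixes f :: "complex ^ 'n \<Rightarrow> complex"
  assumes f: "holomorphic_cvec_on f (ball w R)"
  shows "ennreal (norm (f w)) * emeasure lborel (ball w R)
    \<le> (\<integral>\<^sup>+x\<in>ball w R. ennreal (norm (f x)) \<partial>lborel)"
proof -
  define g where "g x = ennreal (norm (f x)) * indicator (ball w R) x" for x
  let ?I = "indicator {0..2 * pi} :: real \<Rightarrow> ennreal"
  have cf: "continuous_on (ball w R) f"
    using f by (rule holomorphic_cvec_on_imp_continuous_on)
  have "(\<lambda>x. ennreal (indicator (ball w R) x *\<^sub>R norm (f x))) \<in> borel_measurable borel"
    by (intro measurable_compose[OF _ measurable_ennreal] borel_measurable_continuous_on_indicator
        continuous_intros cf) auto
  also have "(\<lambda>x. ennreal (indicator (ball w R) x *\<^sub>R norm (f x))) = g"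
    by (auto simp: g_def fun_eq_iff indicator_def)
  finally have g[measurable]: "g \<in> borel_measurable borel" .
  have mem: "w + cis t *s v \<in> ball w R \<longleftrightarrow> v \<in> ball 0 R" for t v
    by (simp add: dist_norm norm_vector_smult)
  have circ: "ennreal (2 * pi * norm (f w)) * indicator (ball 0 R) v
      \<le> (\<integral>\<^sup>+t. ?I t * g (w + cis t *s v) \<partial>lborel)" for v
  proof (cases "v \<in> ball 0 R")
    case True
    let ?G = "\<lambda>l. f (w + l *s v)"
    have hol: "?G holomorphic_on cball 0 1"
    proof (rule holomorphic_on_line[OF f])
      fix l :: complex assume "l \<in> cball 0 1"
      then have "norm l * norm v \<le> 1 * norm v" by (intro mult_right_mono) auto
      with True show "w + l *s v \<in> ball w R"
        by (simp add: dist_norm norm_vector_smult)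
    qed
    have "ennreal (2 * pi * norm (f w))
        = ennreal (norm (LINT t:{0..2 * pi}|lborel. ?G (cis t)))"
      using circle_mean_value(2)[OF hol] by (simp add: norm_mult)
    also have "\<dots> \<le> (\<integral>\<^sup>+t. ennreal (norm (indicator {0..2 * pi} t *\<^sub>R ?G (cis t))) \<partial>lborel)"
      using circle_mean_value(1)[OF hol]
      unfolding set_lebesgue_integral_def set_integrable_def
      by (intro integral_norm_bound_ennreal) simp
    also have "\<dots> = (\<integral>\<^sup>+t. ?I t * g (w + cis t *s v) \<partial>lborel)"
      using True mem[of _ v] by (intro nn_integral_cong) (simp add: g_def indicator_def)
    finally show ?thesis using True by simp
  qed auto
  have "ennreal (2 * pi) * (ennreal (norm (f w)) * emeasure lborel (ball w R))
      = (\<integral>\<^sup>+v. ennreal (2 * pi * norm (f w)) * indicator (ball (0 :: complex ^ 'n) R) v \<partial>lborel)"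
  proof -
    have "emeasure lborel (ball w R) = emeasure lborel (ball (0::complex^'n) R)"
      by (cases "R \<ge> 0") (simp_all add: emeasure_ball ball_empty)
    then show ?thesis
      by (subst nn_integral_cmult_indicator) (auto simp: ennreal_mult mult.assoc)
  qed
  also have "\<dots> \<le> (\<integral>\<^sup>+v. (\<integral>\<^sup>+t. ?I t * g (w + cis t *s v) \<partial>lborel) \<partial>lborel)"
    by (intro nn_integral_mono circ)
  also have "\<dots> = (\<integral>\<^sup>+t. (\<integral>\<^sup>+v. ?I t * g (w + cis t *s v) \<partial>lborel) \<partial>lborel)"
  proof -
    have [measurable]: "(\<lambda>x. w + cis (snd x) *s fst x) \<in> borel_measurable (borel \<Otimes>\<^sub>M borel)"
      unfolding borel_prod by (intro borel_measurable_continuous_onI continuous_intros)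
    have [measurable]: "(\<lambda>x. w + cis (fst x) *s snd x) \<in> borel_measurable (borel \<Otimes>\<^sub>M borel)"
      unfolding borel_prod by (intro borel_measurable_continuous_onI continuous_intros)
    show ?thesis
      by (rule lborel_pair.Fubini') (simp add: split_beta')
  qed
  also have "\<dots> = (\<integral>\<^sup>+t. ?I t * (\<integral>\<^sup>+v. g v \<partial>lborel) \<partial>lborel)"
  proof (rule nn_integral_cong)
    fix t
    have [measurable]: "(\<lambda>v. w + cis t *s v) \<in> borel_measurable borel"
      by (intro borel_measurable_continuous_onI continuous_intros)
    have "(\<integral>\<^sup>+v. ?I t * g (w + cis t *s v) \<partial>lborel) = ?I t * (\<integral>\<^sup>+v. g (w + cis t *s v) \<partial>lborel)"
      by (rule nn_integral_cmult) measurable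
    also have "(\<integral>\<^sup>+v. g (w + cis t *s v) \<partial>lborel) = (\<integral>\<^sup>+v. g (w + v) \<partial>lborel)"
      by (rule nn_integral_lborel_rotate) auto
    also have "\<dots> = (\<integral>\<^sup>+v. g v \<partial>lborel)"
      by (rule nn_integral_lborel_translate) measurable
    finally show "(\<integral>\<^sup>+v. ?I t * g (w + cis t *s v) \<partial>lborel) = ?I t * (\<integral>\<^sup>+v. g v \<partial>lborel)" .
  qed
  also have "\<dots> = ennreal (2 * pi) * (\<integral>\<^sup>+v. g v \<partial>lborel)"
    by (subst nn_integral_multc) auto
  finally have "ennreal (norm (f w)) * emeasure lborel (ball w R) \<le> (\<integral>\<^sup>+v. g v \<partial>lborel)"
    by (subst (asm) ennreal_mult_le_mult_iff) (auto simp: ennreal_eq_0_iff, insert pi_gt_zero, linarith)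
  then show ?thesis by (simp add: g_def)
qed

section \<open>Boundedness of point evaluations\<close>

text \<open>
  The \<open>p\<close>-th power of the norm. Unlike the norm, it is an integral and commutes with averages over
  parameters.
\<close>

definition Ap_mass :: "real \<Rightarrow> (complex ^ 'n) set \<Rightarrow> (complex ^ 'n \<Rightarrow> complex) \<Rightarrow> real" where
  "Ap_mass p \<Omega> f = (LINT x:\<Omega>|lebesgue. norm (f x) powr p)"

lemma Ap_norm_eq: "Ap_norm p \<Omega> f = Ap_mass p \<Omega> f powr (1 / p)"
  by (simp add: Ap_norm_def Ap_mass_def)

lemma Ap_mass_nonneg [simp]: "0 \<le> Ap_mass p \<Omega> f"
  by (auto simp: Ap_mass_def set_lebesgue_integral_def intro!: integral_nonneg_AE)

lemma borel_measurable_norm_powr: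
  assumes "holomorphic_cvec_on f \<Omega>" and "open \<Omega>" and "p > 0"
  shows "(\<lambda>x. indicator \<Omega> x *\<^sub>R norm (f x) powr p) \<in> borel_measurable borel"
proof (rule borel_measurable_continuous_on_indicator)
  show "\<Omega> \<in> sets borel" using assms by auto
  show "continuous_on \<Omega> (\<lambda>x. norm (f x) powr p)"
    using assms holomorphic_cvec_on_imp_continuous_on[OF assms(1)]
    by (intro continuous_on_powr' continuous_intros) auto
qed

lemma Ap_iff_lborel:
  assumes "open \<Omega>" and "p > 0"
  shows "f \<in> Ap p \<Omega> \<longleftrightarrow>
    holomorphic_cvec_on f \<Omega> \<and> set_integrable lborel \<Omega> (\<lambda>x. norm (f x) powr p)"
  using integrable_completion[of "\<lambda>x. indicator \<Omega> x *\<^sub>R norm (f x) powr p" lborel]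
    borel_measurable_norm_powr[of f \<Omega> p] assms
  by (auto simp: Ap_def set_integrable_def)

lemma Ap_mass_lborel:
  assumes "open \<Omega>" and "p > 0" and "holomorphic_cvec_on f \<Omega>"
  shows "Ap_mass p \<Omega> f = (LINT x:\<Omega>|lborel. norm (f x) powr p)"
  using integral_completion[of "\<lambda>x. indicator \<Omega> x *\<^sub>R norm (f x) powr p" lborel]
    borel_measurable_norm_powr[of f \<Omega> p] assms
  by (auto simp: Ap_mass_def set_lebesgue_integral_def)

lemma Ap_holomorphic: "f \<in> Ap p \<Omega> \<Longrightarrow> holomorphic_cvec_on f \<Omega>"
  by (simp add: Ap_def)

lemma Ap_nn_integral_eq_mass:
  assumes "open \<Omega>" and "p > 0" and "f \<in> Ap p \<Omega>"
  shows "(\<integral>\<^sup>+x\<in>\<Omega>. ennreal (norm (f x) powr p) \<partial>lborel) = ennreal (Ap_mass p \<Omega> f)"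
proof -
  have "(\<integral>\<^sup>+x. ennreal (indicator \<Omega> x *\<^sub>R norm (f x) powr p) \<partial>lborel)
      = ennreal (LINT x|lborel. indicator \<Omega> x *\<^sub>R norm (f x) powr p)"
    using assms by (intro nn_integral_eq_integral) (auto simp: Ap_iff_lborel set_integrable_def)
  moreover have "(\<integral>\<^sup>+x. ennreal (indicator \<Omega> x *\<^sub>R norm (f x) powr p) \<partial>lborel)
      = (\<integral>\<^sup>+x\<in>\<Omega>. ennreal (norm (f x) powr p) \<partial>lborel)"
    by (intro nn_integral_cong) (simp add: indicator_def)
  ultimately show ?thesis
    using assms by (simp add: Ap_mass_lborel Ap_holomorphic set_lebesgue_integral_def)
qed

text \<open>
  The mean value inequality controls \<open>|f w|\<close> by the integral of \<open>|f|\<close>, whereas membership in \<open>A\<^sup>p\<close> controls the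
  integral of \<open>|f| powr p\<close>. A pointwise bound of the first by the second on the ball bridges the gap for
  every \<open>p\<close>.
\<close>

lemma Ap_mean_value_affine_bound:
  assumes \<Omega>: "open \<Omega>" and p: "p > 0" and f: "f \<in> Ap p \<Omega>" and ball: "ball w R \<subseteq> \<Omega>"
    and ab: "a \<ge> 0" "b \<ge> 0" and le: "\<And>x. x \<in> ball w R \<Longrightarrow> norm (f x) \<le> a + b * norm (f x) powr p"
  shows "norm (f w) * measure lborel (ball w R) \<le> a * measure lborel (ball w R) + b * Ap_mass p \<Omega> f"
proof -
  define B where "B = ball w R"
  have [measurable]: "B \<in> sets borel" by (simp add: B_def)
  have V: "emeasure lborel (ball w R) = ennreal (measure lborel (ball w R))"
    using emeasure_lborel_ball_finite[of w R] by (simp add: emeasure_eq_ennreal_measure)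
  have hol: "holomorphic_cvec_on f (ball w R)"
    using f ball by (meson Ap_holomorphic holomorphic_cvec_on_subset)
  have "(\<lambda>x. ennreal (indicator \<Omega> x *\<^sub>R norm (f x) powr p)) \<in> borel_measurable borel"
    using \<Omega> p f by (intro measurable_compose[OF _ measurable_ennreal] borel_measurable_norm_powr)
      (auto simp: Ap_holomorphic)
  also have "(\<lambda>x. ennreal (indicator \<Omega> x *\<^sub>R norm (f x) powr p))
      = (\<lambda>x. ennreal (norm (f x) powr p) * indicator \<Omega> x)"
    by (auto simp: fun_eq_iff indicator_def)
  finally have [measurable]: "(\<lambda>x. ennreal (norm (f x) powr p) * indicator \<Omega> x) \<in> borel_measurable borel" .
  have "ennreal (norm (f w) * measure lborel (ball w R)) = ennreal (norm (f w)) * emeasure lborel (ball w R)"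
    by (simp add: V ennreal_mult)
  also have "\<dots> \<le> (\<integral>\<^sup>+x\<in>ball w R. ennreal (norm (f x)) \<partial>lborel)"
    by (rule norm_center_le_ball_integral[OF hol])
  also have "\<dots> \<le> (\<integral>\<^sup>+x. ennreal a * indicator (ball w R) x
      + ennreal b * (ennreal (norm (f x) powr p) * indicator \<Omega> x) \<partial>lborel)"
  proof (rule nn_integral_mono)
    fix x
    show "ennreal (norm (f x)) * indicator (ball w R) x \<le> ennreal a * indicator (ball w R) x
      + ennreal b * (ennreal (norm (f x) powr p) * indicator \<Omega> x)"
    proof (cases "x \<in> ball w R")
      case True
      then have "x \<in> \<Omega>" using ball by auto
      with True show ?thesis
        using le[OF True] ab
        by (simp add: ennreal_leI flip: ennreal_mult ennreal_plus)
    qed auto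
  qed
  also have "\<dots> = ennreal a * emeasure lborel (ball w R) + ennreal b * ennreal (Ap_mass p \<Omega> f)"
    unfolding B_def [symmetric]
    by (subst nn_integral_add)
       (auto simp: nn_integral_cmult nn_integral_cmult_indicator Ap_nn_integral_eq_mass[OF \<Omega> p f])
  also have "\<dots> = ennreal (a * measure lborel (ball w R) + b * Ap_mass p \<Omega> f)"
    using ab by (simp add: V ennreal_mult)
  finally show ?thesis
    using ab by (subst (asm) ennreal_le_iff) auto
qed

lemma powr_le_two_powr_mult:
  assumes "0 \<le> x" "x / 2 * V \<le> (x / 2) powr (1 - p) * J" "0 < p" "0 < V" "0 \<le> J"
  shows "x powr p \<le> (2 powr p / V) * (J::real)"
proof (cases "x = 0")
  case False
  then have x: "x > 0" using assms by simp
  have "(x / 2) powr p * V = (x / 2) powr (p - 1) * (x / 2 * V)"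
    using x by (simp add: powr_diff)
  also have "\<dots> \<le> (x / 2) powr (p - 1) * ((x / 2) powr (1 - p) * J)"
    using assms by (intro mult_left_mono) auto
  also have "\<dots> = J"
    using x by (simp flip: powr_add mult.assoc)
  finally show ?thesis
    using x assms by (simp add: powr_divide field_simps)
qed (use assms in auto)

text \<open>
  For \<open>p \<ge> 1\<close> every \<open>t \<ge> 0\<close> satisfies \<open>t \<le> s + s powr (1 - p) * t powr p\<close>: either \<open>t \<le> s\<close>, or
  \<open>(t / s) powr (p - 1) \<ge> 1\<close>.
\<close>

lemma Ap_point_evaluation_ge_1:
  assumes \<Omega>: "open \<Omega>" and p: "p \<ge> 1" and f: "f \<in> Ap p \<Omega>" and ball: "ball w R \<subseteq> \<Omega>" and R: "R > 0"
  shows "norm (f w) powr p \<le> 2 powr p / measure lborel (ball w R) * Ap_mass p \<Omega> f"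
proof (cases "f w = 0")
  case False
  \<comment> \<open>With this threshold the contribution of \<open>|f| \<le> s\<close> is half of the left-hand side and can be absorbed.\<close>
  define s where "s = norm (f w) / 2"
  have s: "s > 0" using False by (simp add: s_def)
  have V: "measure lborel (ball w R) > 0" using R by (rule content_ball_pos)
  have le: "t \<le> s + s powr (1 - p) * t powr p" if "t \<ge> 0" for t
  proof (cases "t \<le> s")
    case False
    then have t: "t > s" by simp
    have "t = s powr (1 - p) * s powr (p - 1) * t"
      using s by (simp flip: powr_add)
    also have "\<dots> \<le> s powr (1 - p) * t powr (p - 1) * t"
      using s t p by (intro mult_right_mono mult_left_mono powr_mono2) auto
    also have "\<dots> = s powr (1 - p) * t powr p"
      using s t by (simp add: powr_diff)
    finally show ?thesis using s by simp
  qed (use s that in \<open>simp add: add_increasing2\<close>)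
  have "norm (f w) * measure lborel (ball w R)
      \<le> s * measure lborel (ball w R) + s powr (1 - p) * Ap_mass p \<Omega> f"
    using \<Omega> p f ball s le by (intro Ap_mean_value_affine_bound) auto
  then have "norm (f w) / 2 * measure lborel (ball w R) \<le> (norm (f w) / 2) powr (1 - p) * Ap_mass p \<Omega> f"
    by (simp add: s_def algebra_simps)
  then show ?thesis
    using p V by (intro powr_le_two_powr_mult) auto
qed (use assms in auto)

text \<open>
  The integral of \<open>|f| powr p\<close> has to control \<open>|f|\<close> itself, which is a higher power for \<open>p < 1\<close>. At a point \<open>x\<close> maximising \<open>|f|\<close> times a power of the distance to the sphere, \<open>|f|\<close> is comparable to
  its maximum over a ball around \<open>x\<close>; there \<open>|f|\<close> is bounded by \<open>|f| powr p\<close> times a power of that maximum,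
  and the mean value inequality at \<open>x\<close> bounds the maximum itself. The exponent \<open>D / p\<close> of the weight is the one
  that matches the volume of the ball.
\<close>

lemma Ap_point_evaluation_le_1:
  fixes w :: "complex ^ 'n"
  assumes \<Omega>: "open \<Omega>" and p: "0 < p" "p \<le> 1" and f: "f \<in> Ap p \<Omega>" and ball: "cball w R \<subseteq> \<Omega>" and R: "R > 0"
  shows "norm (f w) powr p
    \<le> 2 powr (DIM(complex ^ 'n) / p) / measure lborel (ball w R) * Ap_mass p \<Omega> f"
proof (cases "f w = 0")
  case False
  define D :: real where "D = DIM(complex ^ 'n)"
  define V where "V = measure lborel (ball (0 :: complex ^ 'n) 1)"
  have D: "D > 0" by (simp add: D_def)
  have V: "V > 0" unfolding V_def by (rule content_ball_pos) simp
  have vol: "measure lborel (ball x r) = r powr D * V" if "r > 0" for x :: "complex ^ 'n" and r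
    using that content_ball_conv_unit_ball[of r x] by (simp only: V_def D_def powr_realpow)
  define d where "d x = R - dist w x" for x
  \<comment> \<open>The weight vanishes on the boundary sphere, so the maximum is attained at an interior point, and on
    the ball of half the distance to the boundary the weight changes by a bounded factor only.\<close>
  define h where "h x = norm (f x) * d x powr (D / p)" for x
  have "continuous_on (cball w R) f"
    using f ball by (meson Ap_holomorphic holomorphic_cvec_on_imp_continuous_on continuous_on_subset)
  then have "continuous_on (cball w R) h"
    unfolding h_def d_def using D p
    by (intro continuous_intros continuous_on_powr') (auto simp: dist_commute)
  then obtain x where x: "x \<in> cball w R" and max: "\<And>y. y \<in> cball w R \<Longrightarrow> h y \<le> h x"
    using continuous_attains_sup[of "cball w R" h] R by auto
  have "0 < h w"
    using False R by (simp add: h_def d_def)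
  with max[of w] R have hx: "0 < h x" by simp
  then have fx: "0 < norm (f x)" and dx: "0 < d x"
    using x by (auto simp: h_def d_def zero_less_mult_iff dist_commute le_less)
  define r where "r = d x / 2"
  have r: "r > 0" using dx by (simp add: r_def)
  have near: "norm (f y) \<le> 2 powr (D / p) * norm (f x)" and sub: "y \<in> cball w R"
    if "y \<in> ball x r" for y
  proof -
    have dy: "r \<le> d y"
      using that dist_triangle[of w y x] by (simp add: d_def r_def dist_commute)
    then show "y \<in> cball w R" using r by (simp add: d_def)
    then have "h y \<le> h x" by (rule max)
    have "norm (f y) * r powr (D / p) \<le> h y"
      unfolding h_def using dy r D p by (intro mult_left_mono powr_mono2) auto
    also have "\<dots> \<le> norm (f x) * (2 * r) powr (D / p)"
      using \<open>h y \<le> h x\<close> by (simp add: h_def r_def)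
    also have "\<dots> = 2 powr (D / p) * norm (f x) * r powr (D / p)"
      using r by (simp add: powr_mult)
    finally show "norm (f y) \<le> 2 powr (D / p) * norm (f x)"
      using r by simp
  qed
  \<comment> \<open>Near the maximum point \<open>|f| \<le> T\<close>, hence \<open>|f| \<le> T powr (1 - p) * |f| powr p\<close>, because \<open>p \<le> 1\<close>.\<close>
  define T where "T = 2 powr (D / p) * norm (f x)"
  have T: "T > 0" using fx by (simp add: T_def)
  have le: "norm (f y) \<le> 0 + T powr (1 - p) * norm (f y) powr p" if "y \<in> ball x r" for y
  proof (cases "f y = 0")
    case False
    have "norm (f y) = norm (f y) powr (1 - p) * norm (f y) powr p"
      using False by (simp flip: powr_add)
    also have "\<dots> \<le> T powr (1 - p) * norm (f y) powr p"
      using p near[OF that] by (intro mult_right_mono powr_mono2) (auto simp: T_def)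
    finally show ?thesis by simp
  qed simp
  have "norm (f x) * measure lborel (ball x r) \<le> 0 * measure lborel (ball x r) + T powr (1 - p) * Ap_mass p \<Omega> f"
    using \<Omega> p f sub ball le by (intro Ap_mean_value_affine_bound) auto
  then have "norm (f x) * (r powr D * V) \<le> T powr (1 - p) * Ap_mass p \<Omega> f"
    by (simp add: vol[OF r])
  then have "norm (f x) powr (p - 1) * (norm (f x) * (r powr D * V))
      \<le> norm (f x) powr (p - 1) * (T powr (1 - p) * Ap_mass p \<Omega> f)"
    by (intro mult_left_mono) auto
  moreover have "norm (f x) powr (p - 1) * (norm (f x) * (r powr D * V)) = norm (f x) powr p * r powr D * V"
    using fx by (simp add: powr_diff)
  moreover have "norm (f x) powr (p - 1) * (T powr (1 - p) * Ap_mass p \<Omega> f)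
      = 2 powr (D / p - D) * Ap_mass p \<Omega> f"
  proof -
    have "norm (f x) powr (p - 1) * T powr (1 - p)
        = 2 powr (D / p * (1 - p)) * (norm (f x) powr (p - 1) * norm (f x) powr (1 - p))"
      by (simp add: T_def powr_mult powr_powr)
    also have "\<dots> = 2 powr (D / p - D)"
      using fx p by (simp add: right_diff_distrib flip: powr_add)
    finally show ?thesis by (simp flip: mult.assoc)
  qed
  ultimately have "norm (f x) powr p * r powr D * V \<le> 2 powr (D / p - D) * Ap_mass p \<Omega> f"
    by simp
  then have "2 powr D * (norm (f x) powr p * r powr D * V) \<le> 2 powr D * (2 powr (D / p - D) * Ap_mass p \<Omega> f)"
    by (intro mult_left_mono) auto
  then have *: "norm (f x) powr p * d x powr D * V \<le> 2 powr (D / p) * Ap_mass p \<Omega> f"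
    using dx by (simp add: r_def powr_divide powr_diff)
  have "norm (f w) powr p * R powr D = h w powr p"
    using R p by (simp add: h_def d_def powr_mult powr_powr)
  also have "\<dots> \<le> h x powr p"
    using max[of w] R p \<open>0 < h w\<close> by (intro powr_mono2) auto
  also have "\<dots> = norm (f x) powr p * d x powr D"
    using p by (simp add: h_def powr_mult powr_powr)
  finally have "norm (f w) powr p * R powr D * V \<le> norm (f x) powr p * d x powr D * V"
    using V by (intro mult_right_mono) auto
  with * have "norm (f w) powr p * (R powr D * V) \<le> 2 powr (D / p) * Ap_mass p \<Omega> f"
    by (simp add: mult.assoc)
  then show ?thesis
    using V R by (simp add: vol[OF R] D_def field_simps)
qed simp

text \<open>
  The constant depends on \<open>w\<close> only through the radius, which gives uniform bounds on compact sets.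
\<close>

lemma Ap_point_evaluation:
  fixes \<Omega> :: "(complex ^ 'n) set"
  assumes \<Omega>: "open \<Omega>" and p: "p > 0" and R: "R > 0"
  obtains A where "A > 0" and
    "\<And>f w. f \<in> Ap p \<Omega> \<Longrightarrow> cball w R \<subseteq> \<Omega> \<Longrightarrow> norm (f w) powr p \<le> A * Ap_mass p \<Omega> f"
proof
  define V where "V = measure lborel (ball (0 :: complex ^ 'n) R)"
  define A where "A = (2 powr p + 2 powr (DIM(complex ^ 'n) / p)) / V"
  have V: "V > 0" unfolding V_def using R by (rule content_ball_pos)
  have vol: "measure lborel (ball w R) = V" for w :: "complex ^ 'n"
    using R content_ball_conv_unit_ball[of R w] content_ball_conv_unit_ball[of R "0 :: complex ^ 'n"]
    by (simp add: V_def)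
  show "A > 0" using V by (simp add: A_def add_pos_pos)
  fix f and w :: "complex ^ 'n"
  assume f: "f \<in> Ap p \<Omega>" and w: "cball w R \<subseteq> \<Omega>"
  have m: "0 \<le> Ap_mass p \<Omega> f / V" using V by simp
  show "norm (f w) powr p \<le> A * Ap_mass p \<Omega> f"
  proof (cases "p \<ge> 1")
    case True
    have "norm (f w) powr p \<le> 2 powr p / V * Ap_mass p \<Omega> f"
      using Ap_point_evaluation_ge_1[OF \<Omega> True f _ R, of w] w by (force simp: vol)
    also have "\<dots> \<le> A * Ap_mass p \<Omega> f"
      using V by (intro mult_right_mono) (auto simp: A_def divide_right_mono)
    finally show ?thesis .
  next
    case False
    have "norm (f w) powr p \<le> 2 powr (DIM(complex ^ 'n) / p) / V * Ap_mass p \<Omega> f"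
      using Ap_point_evaluation_le_1[OF \<Omega> p _ f w R] False by (simp add: vol)
    also have "\<dots> \<le> A * Ap_mass p \<Omega> f"
      using V by (intro mult_right_mono) (auto simp: A_def divide_right_mono)
    finally show ?thesis .
  qed
qed

section \<open>Closure properties\<close>

lemma holomorphic_cvec_on_const: "holomorphic_cvec_on (\<lambda>_. c) \<Omega>"
  unfolding holomorphic_cvec_on_def by (auto intro!: exI[of _ "\<lambda>_. 0"])

lemma holomorphic_cvec_on_coord: "holomorphic_cvec_on (\<lambda>x. x $ j - c) \<Omega>"
proof -
  have "((\<lambda>x. x $ j - c) has_derivative (\<lambda>h. h $ j)) (at z)" for z
    by (auto intro!: derivative_eq_intros bounded_linear.has_derivative[OF bounded_linear_vec_nth])
  then show ?thesis
    unfolding holomorphic_cvec_on_def by (metis vector_smult_component)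
qed

lemma holomorphic_cvec_on_add:
  assumes "holomorphic_cvec_on f \<Omega>" "holomorphic_cvec_on g \<Omega>"
  shows "holomorphic_cvec_on (\<lambda>x. f x + g x) \<Omega>"
  unfolding holomorphic_cvec_on_def
proof
  fix z assume "z \<in> \<Omega>"
  then obtain D E where
    "(f has_derivative D) (at z)" "\<And>c v. D (c *s v) = c * D v"
    "(g has_derivative E) (at z)" "\<And>c v. E (c *s v) = c * E v"
    using assms unfolding holomorphic_cvec_on_def by meson
  then show "\<exists>D. ((\<lambda>x. f x + g x) has_derivative D) (at z) \<and> (\<forall>c v. D (c *s v) = c * D v)"
    by (intro exI[of _ "\<lambda>h. D h + E h"]) (auto intro: has_derivative_add simp: algebra_simps)
qed

lemma holomorphic_cvec_on_mult:
  assumes "holomorphic_cvec_on f \<Omega>" "holomorphic_cvec_on g \<Omega>"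
  shows "holomorphic_cvec_on (\<lambda>x. f x * g x) \<Omega>"
  unfolding holomorphic_cvec_on_def
proof
  fix z assume "z \<in> \<Omega>"
  then obtain D E where
    "(f has_derivative D) (at z)" "\<And>c v. D (c *s v) = c * D v"
    "(g has_derivative E) (at z)" "\<And>c v. E (c *s v) = c * E v"
    using assms unfolding holomorphic_cvec_on_def by meson
  then show "\<exists>D. ((\<lambda>x. f x * g x) has_derivative D) (at z) \<and> (\<forall>c v. D (c *s v) = c * D v)"
    by (intro exI[of _ "\<lambda>h. f z * E h + D h * g z"] conjI allI has_derivative_mult)
       (simp_all add: algebra_simps)
qed

lemma powr_norm_add_le:
  fixes a b :: "'a::real_normed_vector"
  assumes "p > 0"
  shows "norm (a + b) powr p \<le> 2 powr p * (norm a powr p + norm b powr p)"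
proof -
  have "norm (a + b) powr p \<le> (2 * max (norm a) (norm b)) powr p"
    using assms norm_triangle_ineq[of a b] by (intro powr_mono2) auto
  also have "\<dots> = 2 powr p * max (norm a) (norm b) powr p"
    by (simp add: powr_mult)
  also have "\<dots> \<le> 2 powr p * (norm a powr p + norm b powr p)"
    by (intro mult_left_mono) (auto simp: max_def)
  finally show ?thesis .
qed

lemma Ap_I_bound:
  assumes \<Omega>: "open \<Omega>" and p: "p > 0" and f: "holomorphic_cvec_on f \<Omega>"
    and B: "set_integrable lborel \<Omega> B" and le: "\<And>x. x \<in> \<Omega> \<Longrightarrow> norm (f x) powr p \<le> B x"
  shows "f \<in> Ap p \<Omega>" and "Ap_mass p \<Omega> f \<le> (LINT x:\<Omega>|lborel. B x)"
proof -
  have int: "set_integrable lborel \<Omega> (\<lambda>x. norm (f x) powr p)"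
    using B unfolding set_integrable_def
    by (rule Bochner_Integration.integrable_bound)
       (use borel_measurable_norm_powr[OF f \<Omega> p] le in \<open>fastforce simp: indicator_def\<close>)+
  then show "f \<in> Ap p \<Omega>" using Ap_iff_lborel[OF \<Omega> p] f by blast
  show "Ap_mass p \<Omega> f \<le> (LINT x:\<Omega>|lborel. B x)"
    unfolding Ap_mass_lborel[OF \<Omega> p f] by (intro set_integral_mono int B le)
qed

lemma Ap_add:
  assumes \<Omega>: "open \<Omega>" and p: "p > 0" and f: "f \<in> Ap p \<Omega>" and g: "g \<in> Ap p \<Omega>"
  shows "(\<lambda>x. f x + g x) \<in> Ap p \<Omega>"
proof (rule Ap_I_bound(1)[OF \<Omega> p])
  show "set_integrable lborel \<Omega> (\<lambda>x. 2 powr p * (norm (f x) powr p + norm (g x) powr p))"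
    using f g by (intro set_integrable_mult_right set_integral_add) (auto simp: Ap_iff_lborel[OF \<Omega> p])
  show "holomorphic_cvec_on (\<lambda>x. f x + g x) \<Omega>"
    using f g by (intro holomorphic_cvec_on_add) (auto dest: Ap_holomorphic)
qed (rule powr_norm_add_le[OF p])

lemma Ap_mult_bounded:
  assumes \<Omega>: "open \<Omega>" and p: "p > 0" and f: "f \<in> Ap p \<Omega>" and h: "holomorphic_cvec_on h \<Omega>"
    and B: "B \<ge> 0" "\<And>x. x \<in> \<Omega> \<Longrightarrow> norm (h x) \<le> B"
  shows "(\<lambda>x. f x * h x) \<in> Ap p \<Omega>" and "Ap_mass p \<Omega> (\<lambda>x. f x * h x) \<le> B powr p * Ap_mass p \<Omega> f"
proof -
  have int: "set_integrable lborel \<Omega> (\<lambda>x. B powr p * norm (f x) powr p)"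
    using f by (intro set_integrable_mult_right) (auto simp: Ap_iff_lborel[OF \<Omega> p])
  have le: "norm (f x * h x) powr p \<le> B powr p * norm (f x) powr p" if "x \<in> \<Omega>" for x
    using B that p
    by (simp add: norm_mult powr_mult mult.commute[of "B powr p"] mult_left_mono powr_mono2)
  note bnd = Ap_I_bound[OF \<Omega> p holomorphic_cvec_on_mult[OF Ap_holomorphic[OF f] h] int le]
  show "(\<lambda>x. f x * h x) \<in> Ap p \<Omega>" by (rule bnd(1))
  show "Ap_mass p \<Omega> (\<lambda>x. f x * h x) \<le> B powr p * Ap_mass p \<Omega> f"
    using bnd(2) f by (simp add: Ap_mass_lborel[OF \<Omega> p] Ap_holomorphic)
qed

lemma Ap_smult:
  assumes \<Omega>: "open \<Omega>" and p: "p > 0" and f: "f \<in> Ap p \<Omega>"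
  shows "(\<lambda>x. c * f x) \<in> Ap p \<Omega>" and "Ap_mass p \<Omega> (\<lambda>x. c * f x) = norm c powr p * Ap_mass p \<Omega> f"
proof -
  show "(\<lambda>x. c * f x) \<in> Ap p \<Omega>"
    using Ap_mult_bounded(1)[OF \<Omega> p f, of "\<lambda>_. c" "norm c"]
    by (simp add: holomorphic_cvec_on_const mult.commute)
  show "Ap_mass p \<Omega> (\<lambda>x. c * f x) = norm c powr p * Ap_mass p \<Omega> f"
    by (simp add: Ap_mass_def norm_mult powr_mult)
qed

lemma Ap_const:
  assumes \<Omega>: "open \<Omega>" "bounded \<Omega>" and p: "p > 0"
  shows "(\<lambda>_. c) \<in> Ap p \<Omega>"
  using assms emeasure_bounded_finite[of \<Omega>]
  by (auto simp: Ap_iff_lborel holomorphic_cvec_on_const set_integrable_def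
      intro!: integrable_scaleR_left integrable_real_indicator)

section \<open>The extremal problem and its kernel\<close>

lemma m_p_set_bdd_below: "bdd_below {Ap_norm p \<Omega> f |f. f \<in> Ap p \<Omega> \<and> f w = 1}"
  by (rule bdd_belowI[of _ 0]) (auto simp: Ap_norm_eq)

lemma m_p_le:
  assumes \<Omega>: "open \<Omega>" and p: "p > 0" and f: "f \<in> Ap p \<Omega>" and nz: "f w \<noteq> 0"
  shows "m_p p \<Omega> w \<le> Ap_norm p \<Omega> f / norm (f w)"
proof -
  let ?g = "\<lambda>x. inverse (f w) * f x"
  have "m_p p \<Omega> w \<le> Ap_norm p \<Omega> ?g"
    unfolding m_p_def using Ap_smult(1)[OF \<Omega> p f] nz
    by (intro cInf_lower m_p_set_bdd_below) auto
  also have "Ap_norm p \<Omega> ?g = Ap_norm p \<Omega> f / norm (f w)"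
    using p by (simp add: Ap_norm_eq Ap_smult(2)[OF \<Omega> p f] powr_mult powr_powr norm_inverse divide_inverse)
  finally show ?thesis .
qed

text \<open>
  The constant function 1 makes the set of competitors nonempty, so its infimum is approximated.
\<close>

lemma m_p_less_witness:
  assumes "open \<Omega>" "bounded \<Omega>" and p: "p > 0" and t: "m_p p \<Omega> w < t"
  obtains f where "f \<in> Ap p \<Omega>" "f w = 1" "Ap_norm p \<Omega> f < t"
proof -
  let ?S = "{Ap_norm p \<Omega> f |f. f \<in> Ap p \<Omega> \<and> f w = 1}"
  have "?S \<noteq> {}" using Ap_const[OF assms(1-3), of 1] by blast
  moreover have "Inf ?S < t" using t by (simp add: m_p_def)
  ultimately obtain v where "v \<in> ?S" "v < t" by (rule cInf_lessD[THEN bexE])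
  then show ?thesis using that by blast
qed

text \<open>
  Point evaluation is bounded on \<open>A\<^sup>p\<close>, hence a function with value 1 at \<open>w\<close> cannot have small norm.
\<close>

lemma m_p_lower_bound:
  fixes \<Omega> :: "(complex ^ 'n) set"
  assumes \<Omega>: "open \<Omega>" "bounded \<Omega>" and p: "p > 0" and R: "R > 0"
  obtains m where "m > 0" "\<And>w. cball w R \<subseteq> \<Omega> \<Longrightarrow> m \<le> m_p p \<Omega> w"
proof -
  obtain A where A: "A > 0"
    "\<And>f w. f \<in> Ap p \<Omega> \<Longrightarrow> cball w R \<subseteq> \<Omega> \<Longrightarrow> norm (f w) powr p \<le> A * Ap_mass p \<Omega> f"
    using Ap_point_evaluation[OF \<Omega>(1) p R] by blast
  show ?thesis
  proof
    show "(1 / A) powr (1 / p) > 0" using A by simp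
    fix w assume w: "cball w R \<subseteq> \<Omega>"
    show "(1 / A) powr (1 / p) \<le> m_p p \<Omega> w"
    proof (rule ccontr)
      assume "\<not> ?thesis"
      then have "m_p p \<Omega> w < (1 / A) powr (1 / p)" by simp
      then obtain f where f: "f \<in> Ap p \<Omega>" "f w = 1" "Ap_norm p \<Omega> f < (1 / A) powr (1 / p)"
        by (rule m_p_less_witness[OF \<Omega> p])
      then have "(Ap_mass p \<Omega> f powr (1 / p)) powr p < ((1 / A) powr (1 / p)) powr p"
        using f(3) by (intro powr_less_mono2[OF p]) (auto simp: Ap_norm_eq)
      then have "Ap_mass p \<Omega> f < 1 / A"
        using p A by (simp add: powr_powr)
      then show False
        using A(2)[OF f(1) w] f(2) A(1) by (simp add: field_simps)
    qed
  qed
qed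

lemma m_p_pos:
  assumes "open \<Omega>" "bounded \<Omega>" "p > 0" "w \<in> \<Omega>"
  shows "m_p p \<Omega> w > 0"
proof -
  obtain R where R: "R > 0" "cball w R \<subseteq> \<Omega>"
    using assms by (meson open_contains_cball)
  obtain m where "m > 0" "\<And>w. cball w R \<subseteq> \<Omega> \<Longrightarrow> m \<le> m_p p \<Omega> w"
    using m_p_lower_bound[OF assms(1-3) R(1)] by blast
  with R(2) show ?thesis by (meson less_le_trans)
qed

lemma ln_K_p:
  assumes "open \<Omega>" "bounded \<Omega>" "p > 0" "w \<in> \<Omega>"
  shows "ln (K_p p \<Omega> w) = - p * ln (m_p p \<Omega> w)"
  using m_p_pos[OF assms] by (simp add: K_p_def ln_powr)

lemma Ap_mass_pos:
  assumes "open \<Omega>" "bounded \<Omega>" "p > 0" "w \<in> \<Omega>" "f \<in> Ap p \<Omega>" "f w \<noteq> 0"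
  shows "Ap_mass p \<Omega> f > 0"
proof -
  have "0 < Ap_norm p \<Omega> f / norm (f w)"
    using m_p_pos[OF assms(1-4)] m_p_le[OF assms(1,3,5,6)] by linarith
  then have "Ap_mass p \<Omega> f \<noteq> 0"
    by (auto simp: Ap_norm_eq)
  then show ?thesis using Ap_mass_nonneg[of p \<Omega> f] by linarith
qed

text \<open>
  Every member of \<open>A\<^sup>p\<close> with nonzero value at \<open>w\<close> is, after normalisation, a competitor for \<open>m_p\<close> at \<open>w\<close>. This
  is the source of all lower bounds for the kernel away from the base point.
\<close>

lemma ln_K_p_ge:
  assumes "open \<Omega>" "bounded \<Omega>" "p > 0" "w \<in> \<Omega>" "f \<in> Ap p \<Omega>" "f w \<noteq> 0"
  shows "ln (K_p p \<Omega> w) \<ge> p * ln (norm (f w)) - ln (Ap_mass p \<Omega> f)"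
proof -
  have M: "Ap_mass p \<Omega> f > 0" using assms by (rule Ap_mass_pos)
  have "ln (m_p p \<Omega> w) \<le> ln (Ap_norm p \<Omega> f / norm (f w))"
    using m_p_pos[OF assms(1-4)] m_p_le[OF assms(1,3,5,6)] by simp
  also have "\<dots> = ln (Ap_mass p \<Omega> f) / p - ln (norm (f w))"
    using M assms(3,6) by (simp add: Ap_norm_eq ln_div ln_powr)
  finally have "p * ln (m_p p \<Omega> w) \<le> p * (ln (Ap_mass p \<Omega> f) / p - ln (norm (f w)))"
    using assms(3) by (intro mult_left_mono) auto
  then show ?thesis
    using assms(3) by (simp add: ln_K_p[OF assms(1-4)] right_diff_distrib)
qed

text \<open>
  These functions stand in for a minimiser; the tolerance \<open>e\<close> will be of order \<open>r\<^sup>2\<close> on the circle of radius \<open>r\<close>.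
\<close>

lemma near_minimizer:
  assumes "open \<Omega>" "bounded \<Omega>" "p > 0" "w \<in> \<Omega>" and e: "e > 0"
  obtains f where "f \<in> Ap p \<Omega>" "f w = 1" "Ap_mass p \<Omega> f \<le> m_p p \<Omega> w powr p * (1 + e)"
proof -
  have m: "m_p p \<Omega> w > 0" using assms(1-4) by (rule m_p_pos)
  have "1 powr (1 / p) < (1 + e) powr (1 / p)"
    using e assms(3) by (intro powr_less_mono2) auto
  then have "m_p p \<Omega> w < m_p p \<Omega> w * (1 + e) powr (1 / p)"
    using m by simp
  then obtain f where f: "f \<in> Ap p \<Omega>" "f w = 1"
      "Ap_norm p \<Omega> f < m_p p \<Omega> w * (1 + e) powr (1 / p)"
    by (rule m_p_less_witness[OF assms(1-3)])
  have "(Ap_mass p \<Omega> f powr (1 / p)) powr p \<le> (m_p p \<Omega> w * (1 + e) powr (1 / p)) powr p"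
    using f(3) assms(3) by (intro powr_mono2) (auto simp: Ap_norm_eq)
  then have "Ap_mass p \<Omega> f \<le> m_p p \<Omega> w powr p * (1 + e)"
    using assms(3) e by (simp add: powr_powr powr_mult)
  with f show ?thesis using that by blast
qed

text \<open>
  If \<open>f\<close> certifies \<open>m_p < c\<close> at one point, then by continuity its multiples certify it nearby.
\<close>

lemma m_p_upper_semicontinuous:
  assumes \<Omega>: "open \<Omega>" "bounded \<Omega>" and p: "p > 0"
  shows "open {w \<in> \<Omega>. m_p p \<Omega> w < c}"
proof -
  let ?U = "\<lambda>f. {w \<in> \<Omega>. f w \<in> {u. Ap_norm p \<Omega> f < c * norm u}}"
  have "{w \<in> \<Omega>. m_p p \<Omega> w < c} = (\<Union>f\<in>Ap p \<Omega>. ?U f)"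
  proof (intro set_eqI iffI)
    fix w assume w: "w \<in> {w \<in> \<Omega>. m_p p \<Omega> w < c}"
    then obtain f where "f \<in> Ap p \<Omega>" "f w = 1" "Ap_norm p \<Omega> f < c"
      by (auto elim: m_p_less_witness[OF \<Omega> p])
    with w show "w \<in> (\<Union>f\<in>Ap p \<Omega>. ?U f)" by (intro UN_I[of f]) auto
  next
    fix w assume "w \<in> (\<Union>f\<in>Ap p \<Omega>. ?U f)"
    then obtain f where f: "f \<in> Ap p \<Omega>" "w \<in> \<Omega>" "Ap_norm p \<Omega> f < c * norm (f w)"
      by auto
    have "0 \<le> Ap_norm p \<Omega> f" by (simp add: Ap_norm_eq)
    with f(3) have nz: "f w \<noteq> 0" by auto
    have "m_p p \<Omega> w \<le> Ap_norm p \<Omega> f / norm (f w)"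
      by (rule m_p_le[OF \<Omega>(1) p f(1) nz])
    also have "\<dots> < c" using f(3) nz by (simp add: field_simps)
    finally show "w \<in> {w \<in> \<Omega>. m_p p \<Omega> w < c}" using f(2) by simp
  qed
  moreover have "open (?U f)" if "f \<in> Ap p \<Omega>" for f
  proof -
    have "open {u :: complex. Ap_norm p \<Omega> f < c * norm u}"
      by (intro open_Collect_less continuous_intros)
    then have "open (f -` {u. Ap_norm p \<Omega> f < c * norm u} \<inter> \<Omega>)"
      using \<Omega>(1) holomorphic_cvec_on_imp_continuous_on[OF Ap_holomorphic[OF that]]
      by (simp add: continuous_on_open_vimage del: vimage_Collect_eq)
    also have "f -` {u. Ap_norm p \<Omega> f < c * norm u} \<inter> \<Omega> = ?U f" by auto
    finally show ?thesis .
  qed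
  ultimately show ?thesis by auto
qed

text \<open>
  The circle means in the Levi form are genuine integrals: semicontinuity gives measurability, and \<open>m_p\<close> lies
  between two positive constants along the curve.
\<close>

lemma ln_K_p_circle_integrable:
  fixes \<Omega> :: "(complex ^ 'n) set"
  assumes \<Omega>: "open \<Omega>" "bounded \<Omega>" and p: "p > 0"
    and \<gamma>: "continuous_on UNIV \<gamma>" and R: "R > 0" and sub: "\<And>t::real. cball (\<gamma> t) R \<subseteq> \<Omega>"
  shows "set_integrable lborel {a..b} (\<lambda>t. ln (K_p p \<Omega> (\<gamma> t)))"
proof -
  have mem: "\<gamma> t \<in> \<Omega>" for t
    using sub[of t] R by (meson centre_in_cball less_imp_le subsetD)
  obtain m where m: "m > 0" "\<And>w. cball w R \<subseteq> \<Omega> \<Longrightarrow> m \<le> m_p p \<Omega> w"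
    using m_p_lower_bound[OF \<Omega> p R] by blast
  define M where "M = Ap_norm p \<Omega> (\<lambda>_. 1)"
  have lo: "m \<le> m_p p \<Omega> (\<gamma> t)" and hi: "m_p p \<Omega> (\<gamma> t) \<le> M" for t
    using m(2)[OF sub] m_p_le[OF \<Omega>(1) p Ap_const[OF \<Omega> p, of 1]] by (auto simp: M_def)
  have meas: "(\<lambda>t. m_p p \<Omega> (\<gamma> t)) \<in> borel_measurable borel"
  proof (rule borel_measurableI_less)
    fix c
    have "open (\<gamma> -` {w \<in> \<Omega>. m_p p \<Omega> w < c})"
      by (rule open_vimage[OF m_p_upper_semicontinuous[OF \<Omega> p] \<gamma>])
    also have "\<gamma> -` {w \<in> \<Omega>. m_p p \<Omega> w < c} = {t \<in> space borel. m_p p \<Omega> (\<gamma> t) < c}"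
      using mem by auto
    finally show "{t \<in> space borel. m_p p \<Omega> (\<gamma> t) < c} \<in> sets borel" by simp
  qed
  have eq: "ln (K_p p \<Omega> (\<gamma> t)) = - p * ln (m_p p \<Omega> (\<gamma> t))" for t
    by (rule ln_K_p[OF \<Omega> p mem])
  have bnd: "\<bar>ln (m_p p \<Omega> (\<gamma> t))\<bar> \<le> \<bar>ln m\<bar> + \<bar>ln M\<bar>" for t
  proof -
    have "ln m \<le> ln (m_p p \<Omega> (\<gamma> t))" "ln (m_p p \<Omega> (\<gamma> t)) \<le> ln M"
      using lo[of t] hi[of t] m(1) by auto
    then show ?thesis by linarith
  qed
  have "set_integrable lborel {a..b} (\<lambda>t. ln (m_p p \<Omega> (\<gamma> t)))"
    unfolding set_integrable_def
  proof (rule Bochner_Integration.integrable_bound)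
    show "integrable lborel (\<lambda>t::real. indicator {a..b} t *\<^sub>R (\<bar>ln m\<bar> + \<bar>ln M\<bar>))"
      by (intro integrable_scaleR_left integrable_real_indicator) (auto simp: emeasure_lborel_Icc_eq)
    show "(\<lambda>t. indicator {a..b} t *\<^sub>R ln (m_p p \<Omega> (\<gamma> t))) \<in> borel_measurable lborel"
      using meas by measurable
  qed (use bnd in \<open>auto simp: indicator_def\<close>)
  then show ?thesis
    unfolding eq by (rule set_integrable_mult_right[rotated])
qed

section \<open>Circle means of powers\<close>

lemma powr_one_plus_le_quadratic:
  fixes q e :: real
  assumes "e > 0"
  obtains d where "d > 0" "\<And>s. \<bar>s\<bar> < d \<Longrightarrow> (1 + s) powr q \<le> 1 + q * s + (q * (q - 1) / 2 + e) * s\<^sup>2"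
proof -
  have "((\<lambda>s::real. ((1 + s) powr q - 1 - q * s) / s\<^sup>2) \<longlongrightarrow> q * (q - 1) / 2) (at 0)"
    by real_asymp
  then have "eventually (\<lambda>s. ((1 + s) powr q - 1 - q * s) / s\<^sup>2 < q * (q - 1) / 2 + e) (at 0)"
    using assms by (intro order_tendstoD(2)) auto
  then obtain d where d: "d > 0"
      "\<And>s. s \<noteq> 0 \<Longrightarrow> \<bar>s\<bar> < d \<Longrightarrow> ((1 + s) powr q - 1 - q * s) / s\<^sup>2 < q * (q - 1) / 2 + e"
    unfolding eventually_at by auto
  show ?thesis
  proof (rule that[OF d(1)])
    fix s :: real assume s: "\<bar>s\<bar> < d"
    show "(1 + s) powr q \<le> 1 + q * s + (q * (q - 1) / 2 + e) * s\<^sup>2"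
    proof (cases "s = 0")
      case False
      then have "(1 + s) powr q - 1 - q * s < (q * (q - 1) / 2 + e) * s\<^sup>2"
        using d(2)[OF False s] by (simp add: pos_divide_less_eq)
      then show ?thesis by simp
    qed simp
  qed
qed

lemma set_integrable_Icc_continuous:
  fixes f :: "real \<Rightarrow> 'a::{banach, second_countable_topology}"
  assumes "continuous_on {a..b} f"
  shows "set_integrable lborel {a..b} f"
  unfolding set_integrable_def using assms by (intro borel_integrable_compact) auto

lemma continuous_on_norm_circle_powr:
  fixes u v :: complex
  assumes "p > 0"
  shows "continuous_on S (\<lambda>t. norm (u + cis (- t) * v) powr p)"
  using assms by (intro continuous_on_powr' continuous_intros) auto

lemma circle_integral_quadratic:
  fixes a b c0 c1 c2 :: real
  defines "x \<equiv> \<lambda>t. a * cos t + b * sin t"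
  shows "(LINT t:{0..2 * pi}|lborel. c0 + c1 * x t + c2 * (x t)\<^sup>2) = 2 * pi * c0 + pi * c2 * (a\<^sup>2 + b\<^sup>2)"
proof -
  \<comment> \<open>An explicit antiderivative.\<close>
  define F where "F t = c0 * t + c1 * (a * sin t - b * cos t)
    + c2 * (a\<^sup>2 * (t / 2 + sin t * cos t / 2) + b\<^sup>2 * (t / 2 - sin t * cos t / 2) + a * b * (sin t)\<^sup>2)" for t
  have "DERIV F t :> c0 + c1 * x t + c2 * (x t)\<^sup>2" for t
  proof -
    have sc: "(cos t)\<^sup>2 = 1 - (sin t)\<^sup>2" by (rule cos_squared_eq)
    have "DERIV F t :> c0 + c1 * (a * cos t + b * sin t)
      + c2 * (a\<^sup>2 * (1 / 2 + ((cos t)\<^sup>2 - (sin t)\<^sup>2) / 2) + b\<^sup>2 * (1 / 2 - ((cos t)\<^sup>2 - (sin t)\<^sup>2) / 2)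
        + a * b * (2 * sin t * cos t))"
      unfolding F_def by (auto intro!: derivative_eq_intros simp: power2_eq_square field_simps)
    moreover have "a\<^sup>2 * (1 / 2 + ((cos t)\<^sup>2 - (sin t)\<^sup>2) / 2) + b\<^sup>2 * (1 / 2 - ((cos t)\<^sup>2 - (sin t)\<^sup>2) / 2)
        + a * b * (2 * sin t * cos t) = (x t)\<^sup>2"
      unfolding x_def power2_sum power_mult_distrib sc by (simp add: field_simps)
    ultimately show ?thesis by (simp add: x_def)
  qed
  then have "(\<integral>t. (c0 + c1 * x t + c2 * (x t)\<^sup>2) * indicator {0..2 * pi} t \<partial>lborel) = F (2 * pi) - F 0"
    by (intro integral_FTC_Icc_real) (auto simp: x_def intro!: continuous_intros)
  then show ?thesis
    by (simp add: set_lebesgue_integral_def F_def mult.commute algebra_simps)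
qed

lemma norm_add_cis_mult_squared:
  "(norm (u + cis (- t) * v))\<^sup>2
    = (norm u)\<^sup>2 + (norm v)\<^sup>2 + 2 * (Re (cnj u * v) * cos t + Im (cnj u * v) * sin t)"
proof -
  have sc: "(cos t)\<^sup>2 + (sin t)\<^sup>2 = 1" by simp
  have "(norm (u + cis (- t) * v))\<^sup>2 = (Re u)\<^sup>2 + (Im u)\<^sup>2 + ((Re v)\<^sup>2 + (Im v)\<^sup>2) * ((cos t)\<^sup>2 + (sin t)\<^sup>2)
    + 2 * (Re (cnj u * v) * cos t + Im (cnj u * v) * sin t)"
    unfolding cmod_power2
    by (simp add: power2_eq_square algebra_simps
        del: sin_cos_squared_add sin_cos_squared_add2 sin_cos_squared_add3)
  then show ?thesis unfolding sc by (simp add: cmod_power2)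
qed

text \<open>
  Write \<open>|1 + cis (- t) * v|\<^sup>2 = 1 + s\<close> with \<open>s = 2 * Re (cis (- t) * v) + |v|\<^sup>2\<close> and expand \<open>(1 + s) powr (p / 2)\<close>
  to second order: the means of \<open>s\<close> and \<open>s\<^sup>2\<close> over the circle are \<open>|v|\<^sup>2\<close> and \<open>2 |v|\<^sup>2\<close> up to terms of order four.
\<close>

lemma circle_mean_powr_le:
  fixes p e :: real
  assumes p: "p > 0" and e: "e > 0"
  obtains d where "d > 0" "\<And>v :: complex. norm v \<le> d \<Longrightarrow>
    (LINT t:{0..2 * pi}|lborel. norm (1 + cis (- t) * v) powr p) \<le> 2 * pi * (1 + (p\<^sup>2 / 4 + e) * (norm v)\<^sup>2)"
proof -
  define q where "q = p / 2"
  \<comment> \<open>The second Taylor coefficient of \<open>(1 + s) powr q\<close>, enlarged by \<open>e / 4\<close>. The circle mean of \<open>s\<^sup>2\<close> is close to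
    \<open>2 |v|\<^sup>2\<close>, and \<open>q + 2 * (q * (q - 1) / 2) = p\<^sup>2 / 4\<close>.\<close>
  define K where "K = q * (q - 1) / 2 + e / 4"
  obtain \<delta> where \<delta>: "\<delta> > 0" "\<And>s. \<bar>s\<bar> < \<delta> \<Longrightarrow> (1 + s) powr q \<le> 1 + q * s + K * s\<^sup>2"
    using powr_one_plus_le_quadratic[of "e / 4" q] e unfolding K_def by auto
  define d where "d = min 1 (min (\<delta> / 4) (e / (2 * (\<bar>K\<bar> + 1))))"
  have d: "d > 0" "d \<le> 1" "d \<le> \<delta> / 4" "d \<le> e / (2 * (\<bar>K\<bar> + 1))"
    using \<delta>(1) e unfolding d_def by (simp, linarith, linarith, linarith)
  show ?thesis
  proof (rule that[OF d(1)])
    fix v :: complex assume v: "norm v \<le> d"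
    define \<rho> where "\<rho> = norm v"
    define x where "x t = Re v * cos t + Im v * sin t" for t
    have \<rho>: "0 \<le> \<rho>" "\<rho> \<le> d" "\<rho>\<^sup>2 = (Re v)\<^sup>2 + (Im v)\<^sup>2"
      using v by (auto simp: \<rho>_def cmod_power2)
    have "\<rho>\<^sup>2 \<le> \<rho> * 1"
      unfolding power2_eq_square using \<rho> d by (intro mult_left_mono) auto
    then have \<rho>2: "\<rho>\<^sup>2 \<le> d" using \<rho> by simp
    have xle: "\<bar>x t\<bar> \<le> \<rho>" for t
    proof -
      have "x t = Re (cis (- t) * v)" by (simp add: x_def)
      then show ?thesis
        using abs_Re_le_cmod[of "cis (- t) * v"] by (simp add: \<rho>_def norm_mult)
    qed
    have le: "norm (1 + cis (- t) * v) powr p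
        \<le> (1 + q * \<rho>\<^sup>2 + K * \<rho>\<^sup>2 * \<rho>\<^sup>2) + (2 * q + 4 * K * \<rho>\<^sup>2) * x t + 4 * K * (x t)\<^sup>2" for t
    proof -
      define s where "s = 2 * x t + \<rho>\<^sup>2"
      have sq: "(norm (1 + cis (- t) * v))\<^sup>2 = 1 + s"
        using norm_add_cis_mult_squared[of 1 t v] by (simp add: s_def x_def \<rho>_def)
      have "norm (1 + cis (- t) * v) powr p = (norm (1 + cis (- t) * v) powr 2) powr q"
        unfolding powr_powr by (simp add: q_def)
      also have "\<dots> = (1 + s) powr q"
        by (simp add: sq)
      also have "\<dots> \<le> 1 + q * s + K * s\<^sup>2"
      proof (rule \<delta>(2))
        have "\<bar>s\<bar> \<le> 2 * \<bar>x t\<bar> + \<rho>\<^sup>2" by (simp add: s_def abs_triangle_ineq[THEN order_trans])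
        then show "\<bar>s\<bar> < \<delta>" using xle[of t] \<rho> \<rho>2 d \<delta>(1) by linarith
      qed
      also have "\<dots> = (1 + q * \<rho>\<^sup>2 + K * \<rho>\<^sup>2 * \<rho>\<^sup>2) + (2 * q + 4 * K * \<rho>\<^sup>2) * x t + 4 * K * (x t)\<^sup>2"
        by (simp add: s_def power2_eq_square algebra_simps)
      finally show ?thesis .
    qed
    have "(LINT t:{0..2 * pi}|lborel. norm (1 + cis (- t) * v) powr p)
      \<le> (LINT t:{0..2 * pi}|lborel. (1 + q * \<rho>\<^sup>2 + K * \<rho>\<^sup>2 * \<rho>\<^sup>2) + (2 * q + 4 * K * \<rho>\<^sup>2) * x t + 4 * K * (x t)\<^sup>2)"
      using p le unfolding x_def
      by (intro set_integral_mono set_integrable_Icc_continuous continuous_on_norm_circle_powr continuous_intros)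
    also have "\<dots> = 2 * pi * (1 + q * \<rho>\<^sup>2 + K * \<rho>\<^sup>2 * \<rho>\<^sup>2) + pi * (4 * K) * \<rho>\<^sup>2"
      unfolding x_def \<rho>(3) by (rule circle_integral_quadratic)
    also have "\<dots> = 2 * pi * (1 + (q + 2 * K + K * \<rho>\<^sup>2) * \<rho>\<^sup>2)"
      by (simp add: algebra_simps)
    also have "\<dots> \<le> 2 * pi * (1 + (p\<^sup>2 / 4 + e) * \<rho>\<^sup>2)"
    proof -
      have "q + 2 * K = p\<^sup>2 / 4 + e / 2"
        by (simp add: K_def q_def power2_eq_square field_simps)
      moreover have "K * \<rho>\<^sup>2 \<le> (\<bar>K\<bar> + 1) * d"
        using \<rho>2 d by (intro mult_mono) auto
      moreover have "(\<bar>K\<bar> + 1) * d \<le> e / 2"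
        using d(4) by (simp add: field_simps)
      ultimately show ?thesis
        by (intro mult_left_mono add_left_mono mult_right_mono) auto
    qed
    finally show "(LINT t:{0..2 * pi}|lborel. norm (1 + cis (- t) * v) powr p)
        \<le> 2 * pi * (1 + (p\<^sup>2 / 4 + e) * (norm v)\<^sup>2)"
      by (simp add: \<rho>_def)
  qed
qed

lemma circle_mean_square:
  "(LINT t:{0..2 * pi}|lborel. (norm (u + cis (- t) * v))\<^sup>2) = 2 * pi * ((norm u)\<^sup>2 + (norm v)\<^sup>2)"
  using circle_integral_quadratic[of "(norm u)\<^sup>2 + (norm v)\<^sup>2" 2 "Re (cnj u * v)" "Im (cnj u * v)" 0]
  by (simp only: norm_add_cis_mult_squared) simp

text \<open>
  The pointwise form of Hoelder's inequality with exponents \<open>p / (p - 2)\<close> and \<open>p / 2\<close>, scaled such that integrating it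
  over functions with \<open>\<integral>|f| powr p = N\<close> and \<open>\<integral>|\<phi>| powr p = 1\<close> loses nothing.
\<close>

lemma young_powr_square:
  fixes a b N p :: real
  assumes p: "p > 2" and N: "N > 0" and ab: "a \<ge> 0" "b \<ge> 0"
  shows "a powr (p - 2) * b\<^sup>2
    \<le> N powr (1 - 2 / p) * ((1 - 2 / p) * (a powr p / N) + 2 / p * b powr p)"
proof (cases "a = 0 \<or> b = 0")
  case True
  then show ?thesis using assms by auto
next
  case False
  then have a: "a > 0" and b: "b > 0" using ab by auto
  have "(a powr p / N) powr (1 - 2 / p) * (b powr p) powr (2 / p)
      \<le> (1 - 2 / p) * (a powr p / N) + 2 / p * b powr p"
    using p N a b by (intro Youngs_inequality_0) auto
  also have "(b powr p) powr (2 / p) = b\<^sup>2"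
    using p b by (simp add: powr_powr)
  also have "(a powr p / N) powr (1 - 2 / p) = a powr (p - 2) / N powr (1 - 2 / p)"
    using p N a by (simp add: powr_divide powr_powr right_diff_distrib)
  finally show ?thesis
    using N by (simp add: field_simps)
qed

text \<open>
  Where \<open>\<tau> |v|\<close> is small compared with \<open>|u|\<close>, the second order expansion applies and its quadratic term
  \<open>|u| powr (p - 2) * \<tau>\<^sup>2 |v|\<^sup>2\<close> is split by Young's inequality. Elsewhere everything is bounded by a multiple of
  \<open>\<tau> powr p * |v| powr p\<close>, which is \<open>o(\<tau>\<^sup>2)\<close> if \<open>p > 2\<close>. For \<open>p = 2\<close> the mean is given by the parallelogram law.
\<close>

lemma circle_mean_powr_le_young:
  fixes p e N :: real
  assumes p: "p \<ge> 2" and e: "e > 0" and N: "N > 0"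
  obtains d where "d > 0" "\<And>(u :: complex) v \<tau>. 0 \<le> \<tau> \<Longrightarrow> \<tau> \<le> d \<Longrightarrow>
    (LINT t:{0..2 * pi}|lborel. norm (u + cis (- t) * (of_real \<tau> * v)) powr p)
    \<le> 2 * pi * (norm u powr p + \<tau>\<^sup>2 * ((p\<^sup>2 / 4 + e) * (N powr (1 - 2 / p)
        * ((1 - 2 / p) * (norm u powr p / N) + 2 / p * norm v powr p)) + e * norm v powr p))"
proof (cases "p = 2")
  case True
  show ?thesis
  proof (rule that[of 1])
    fix u v :: complex and \<tau> :: real assume "0 \<le> \<tau>"
    have "(norm u)\<^sup>2 + (norm (of_real \<tau> * v))\<^sup>2 \<le> (norm u)\<^sup>2 + \<tau>\<^sup>2 * ((1 + e) * (norm v)\<^sup>2 + e * (norm v)\<^sup>2)"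
      using e by (simp add: norm_mult power_mult_distrib algebra_simps)
    then show "(LINT t:{0..2 * pi}|lborel. norm (u + cis (- t) * (of_real \<tau> * v)) powr p)
      \<le> 2 * pi * (norm u powr p + \<tau>\<^sup>2 * ((p\<^sup>2 / 4 + e) * (N powr (1 - 2 / p)
        * ((1 - 2 / p) * (norm u powr p / N) + 2 / p * norm v powr p)) + e * norm v powr p))"
      using N by (simp add: True circle_mean_square)
  qed simp
next
  case False
  with p have p2: "p > 2" by simp
  obtain d1 where d1: "d1 > 0" "\<And>v :: complex. norm v \<le> d1 \<Longrightarrow>
    (LINT t:{0..2 * pi}|lborel. norm (1 + cis (- t) * v) powr p) \<le> 2 * pi * (1 + (p\<^sup>2 / 4 + e) * (norm v)\<^sup>2)"
    using circle_mean_powr_le[of p e] p2 e by auto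
  define C where "C = (1 / d1 + 1) powr p"
  \<comment> \<open>Here \<open>p > 2\<close> enters: \<open>C \<tau> powr p \<le> e \<tau>\<^sup>2\<close> for all \<open>\<tau> \<le> d\<close>.\<close>
  define d where "d = (e / C) powr (1 / (p - 2))"
  have "1 / d1 + 1 > 0" using d1(1) by (simp add: add_pos_pos)
  then have C: "C > 0" by (simp add: C_def)
  have d: "d > 0" using e C by (simp add: d_def)
  show ?thesis
  proof (rule that[OF d])
    fix u v :: complex and \<tau> :: real assume \<tau>: "0 \<le> \<tau>" "\<tau> \<le> d"
    define Y where "Y = N powr (1 - 2 / p) * ((1 - 2 / p) * (norm u powr p / N) + 2 / p * norm v powr p)"
    have Y: "norm u powr (p - 2) * (norm v)\<^sup>2 \<le> Y"
      unfolding Y_def using p2 N by (intro young_powr_square) auto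
    have Y0: "0 \<le> Y" by (rule order_trans[OF _ Y]) simp
    let ?L = "LINT t:{0..2 * pi}|lborel. norm (u + cis (- t) * (of_real \<tau> * v)) powr p"
    have "?L \<le> 2 * pi * (norm u powr p + \<tau>\<^sup>2 * ((p\<^sup>2 / 4 + e) * Y + e * norm v powr p))"
    proof (cases "\<tau> * norm v \<le> d1 * norm u \<and> u \<noteq> 0")
      case True
      let ?w = "of_real \<tau> * v / u"
      have w: "norm ?w = \<tau> * norm v / norm u" using \<tau> by (simp add: norm_mult norm_divide)
      have wd: "norm ?w \<le> d1" unfolding w using True by (simp add: pos_divide_le_eq)
      have "norm (u + cis (- t) * (of_real \<tau> * v)) powr p = norm u powr p * norm (1 + cis (- t) * ?w) powr p" for t
      proof -
        have "u + cis (- t) * (of_real \<tau> * v) = u * (1 + cis (- t) * ?w)"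
          using True by (simp add: field_simps)
        then show ?thesis by (simp add: norm_mult powr_mult)
      qed
      then have "?L = norm u powr p * (LINT t:{0..2 * pi}|lborel. norm (1 + cis (- t) * ?w) powr p)"
        by simp
      also have "\<dots> \<le> norm u powr p * (2 * pi * (1 + (p\<^sup>2 / 4 + e) * (norm ?w)\<^sup>2))"
        using wd by (intro mult_left_mono d1(2)) auto
      also have "\<dots> = 2 * pi * (norm u powr p + \<tau>\<^sup>2 * ((p\<^sup>2 / 4 + e) * (norm u powr (p - 2) * (norm v)\<^sup>2)))"
        using True unfolding w by (simp add: powr_diff power_divide power_mult_distrib field_simps)
      also have "\<dots> \<le> 2 * pi * (norm u powr p + \<tau>\<^sup>2 * ((p\<^sup>2 / 4 + e) * Y + e * norm v powr p))"
      proof -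
        have "(p\<^sup>2 / 4 + e) * (norm u powr (p - 2) * (norm v)\<^sup>2) \<le> (p\<^sup>2 / 4 + e) * Y + e * norm v powr p"
          using e Y by (intro add_increasing2 mult_left_mono) auto
        then show ?thesis by (intro mult_left_mono add_left_mono) auto
      qed
      finally show ?thesis .
    next
      case False
      then have u: "norm u \<le> \<tau> * norm v / d1"
        using d1(1) \<tau> by (auto simp: field_simps)
      have le: "norm (u + cis (- t) * (of_real \<tau> * v)) powr p \<le> \<tau>\<^sup>2 * (e * norm v powr p)" for t
      proof -
        have "norm (u + cis (- t) * (of_real \<tau> * v)) \<le> norm u + \<tau> * norm v"
          using norm_triangle_ineq[of u "cis (- t) * (of_real \<tau> * v)"] \<tau> by (simp add: norm_mult)
        also have "\<dots> \<le> (1 / d1 + 1) * (\<tau> * norm v)"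
          using u by (simp add: algebra_simps)
        finally have "norm (u + cis (- t) * (of_real \<tau> * v)) powr p \<le> ((1 / d1 + 1) * (\<tau> * norm v)) powr p"
          using p2 by (intro powr_mono2) auto
        also have "\<dots> = C * (\<tau> powr p * norm v powr p)"
          using d1(1) \<tau> by (simp add: C_def powr_mult)
        also have "\<dots> \<le> \<tau>\<^sup>2 * (e * norm v powr p)"
        proof (cases "\<tau> = 0")
          case False
          then have "\<tau> powr p = \<tau>\<^sup>2 * \<tau> powr (p - 2)"
            using \<tau> by (simp add: powr_diff)
          moreover have "C * \<tau> powr (p - 2) \<le> e"
          proof -
            have "\<tau> powr (p - 2) \<le> d powr (p - 2)" using \<tau> p2 by (intro powr_mono2) auto
            also have "\<dots> = e / C" using p2 e C by (simp add: d_def powr_powr)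
            finally show ?thesis using C by (simp add: field_simps)
          qed
          then have "\<tau>\<^sup>2 * norm v powr p * (C * \<tau> powr (p - 2)) \<le> \<tau>\<^sup>2 * norm v powr p * e"
            by (intro mult_left_mono) auto
          ultimately show ?thesis by (simp add: algebra_simps)
        qed (use p2 in simp)
        finally show ?thesis .
      qed
      have "?L \<le> (LINT t:{0..2 * pi}|lborel. \<tau>\<^sup>2 * (e * norm v powr p))"
        using p2 le
        by (intro set_integral_mono set_integrable_Icc_continuous continuous_on_norm_circle_powr continuous_intros) auto
      also have "\<dots> = 2 * pi * (\<tau>\<^sup>2 * (e * norm v powr p))"
        by (simp add: set_lebesgue_integral_def)
      also have "\<dots> \<le> 2 * pi * (norm u powr p + \<tau>\<^sup>2 * ((p\<^sup>2 / 4 + e) * Y + e * norm v powr p))"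
        using e Y0 by (intro mult_left_mono add_increasing add_increasing2) auto
      finally show ?thesis .
    qed
    then show "?L \<le> 2 * pi * (norm u powr p + \<tau>\<^sup>2 * ((p\<^sup>2 / 4 + e) * (N powr (1 - 2 / p)
        * ((1 - 2 / p) * (norm u powr p / N) + 2 / p * norm v powr p)) + e * norm v powr p))"
      by (simp add: Y_def)
  qed
qed

section \<open>Circle means of masses and of logarithms\<close>

text \<open>
  Fubini's theorem on \<open>\<Omega> \<times> [0, 2 \<pi>]\<close>: a bound for the circle mean at each point of \<open>\<Omega>\<close> yields one for the circle
  mean of the masses.
\<close>

lemma Ap_mass_rotating_combination:
  fixes f g :: "complex ^ 'n \<Rightarrow> complex"
  assumes \<Omega>: "open \<Omega>" and p: "p > 0" and f: "f \<in> Ap p \<Omega>" and g: "g \<in> Ap p \<Omega>"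
  defines "m \<equiv> \<lambda>t. Ap_mass p \<Omega> (\<lambda>x. f x + cis (- t) * g x)"
  shows "set_integrable lborel {0..2 * pi} m"
    and "\<lbrakk>set_integrable lborel \<Omega> B; \<And>x. x \<in> \<Omega> \<Longrightarrow>
        (LINT t:{0..2 * pi}|lborel. norm (f x + cis (- t) * g x) powr p) \<le> 2 * pi * B x\<rbrakk>
      \<Longrightarrow> (LINT t:{0..2 * pi}|lborel. m t) \<le> 2 * pi * (LINT x:\<Omega>|lborel. B x)"
proof -
  \<comment> \<open>The integrand on \<open>\<Omega> \<times> [0, 2 \<pi>]\<close>, extended by zero so that it is jointly Borel measurable.\<close>
  define h where "h x t = indicator \<Omega> x *\<^sub>R (indicator {0..2 * pi} t *\<^sub>R norm (f x + cis (- t) * g x) powr p)"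
    for x and t :: real
  have borel: "(\<lambda>x. indicator \<Omega> x *\<^sub>R k x) \<in> borel_measurable borel" if "k \<in> Ap p \<Omega>" for k :: "complex ^ 'n \<Rightarrow> complex"
    using that \<Omega>
    by (intro borel_measurable_continuous_on_indicator)
       (auto dest: Ap_holomorphic holomorphic_cvec_on_imp_continuous_on)
  note [measurable] = borel[OF f] borel[OF g]
  have [measurable]: "(\<lambda>t. cis (- t)) \<in> borel_measurable borel"
    by (intro borel_measurable_continuous_onI continuous_intros)
  have h_eq: "case_prod h = (\<lambda>(x, t). indicator {0..2 * pi} t *\<^sub>R
      norm (indicator \<Omega> x *\<^sub>R f x + cis (- t) * (indicator \<Omega> x *\<^sub>R g x)) powr p)"
    using p by (auto simp: h_def fun_eq_iff indicator_def)
  have h_meas[measurable]: "case_prod h \<in> borel_measurable (borel \<Otimes>\<^sub>M borel)"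
    unfolding h_eq by measurable
  have h_nonneg: "0 \<le> h x t" for x t by (simp add: h_def)
  have h_t: "integrable lborel (h x)" for x
  proof -
    have "set_integrable lborel {0..2 * pi} (\<lambda>t. norm (f x + cis (- t) * g x) powr p)"
      using p by (intro set_integrable_Icc_continuous continuous_on_norm_circle_powr)
    then show ?thesis
      unfolding h_def set_integrable_def by (rule integrable_scaleR_right)
  qed
  have h_bound: "(\<integral>t. h x t \<partial>lborel) \<le> indicator \<Omega> x *\<^sub>R (2 * pi * (2 powr p * (norm (f x) powr p + norm (g x) powr p)))" for x
  proof -
    have "(\<integral>t. h x t \<partial>lborel) \<le> (\<integral>t. indicator {0..2 * pi} t *\<^sub>R
        (indicator \<Omega> x *\<^sub>R (2 powr p * (norm (f x) powr p + norm (g x) powr p))) \<partial>lborel)"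
    proof (rule integral_mono[OF h_t])
      fix t
      show "h x t \<le> indicator {0..2 * pi} t *\<^sub>R
        (indicator \<Omega> x *\<^sub>R (2 powr p * (norm (f x) powr p + norm (g x) powr p)))"
        using powr_norm_add_le[OF p, of "f x" "cis (- t) * g x"]
        by (simp add: h_def indicator_def norm_mult)
    qed (auto intro!: integrable_scaleR_left integrable_real_indicator simp: emeasure_lborel_Icc_eq)
    then show ?thesis by (simp add: algebra_simps)
  qed
  have int_x: "integrable lborel (\<lambda>x. \<integral>t. norm (h x t) \<partial>lborel)"
  proof (rule Bochner_Integration.integrable_bound)
    show "integrable lborel (\<lambda>x. indicator \<Omega> x *\<^sub>R (2 * pi * (2 powr p * (norm (f x) powr p + norm (g x) powr p))))"
      using f g unfolding set_integrable_def [symmetric]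
      by (intro set_integrable_mult_right set_integral_add) (auto simp: Ap_iff_lborel[OF \<Omega> p])
    show "AE x in lborel. norm (\<integral>t. norm (h x t) \<partial>lborel)
        \<le> norm (indicator \<Omega> x *\<^sub>R (2 * pi * (2 powr p * (norm (f x) powr p + norm (g x) powr p))))"
      using h_bound h_nonneg by (auto simp: integral_nonneg_AE abs_of_nonneg intro!: order_trans[OF h_bound])
  qed measurable
  have h_int: "integrable (lborel \<Otimes>\<^sub>M lborel) (case_prod h)"
  proof (rule lborel_pair.Fubini_integrable)
    show "case_prod h \<in> borel_measurable (lborel \<Otimes>\<^sub>M lborel)" by measurable
    show "integrable lborel (\<lambda>x. \<integral>t. norm (case_prod h (x, t)) \<partial>lborel)" using int_x by simp
    show "AE x in lborel. integrable lborel (\<lambda>t. case_prod h (x, t))" using h_t by simp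
  qed
  have hol: "holomorphic_cvec_on (\<lambda>x. f x + cis (- t) * g x) \<Omega>" for t
    using f g by (intro holomorphic_cvec_on_add holomorphic_cvec_on_mult holomorphic_cvec_on_const)
      (auto dest: Ap_holomorphic)
  have m_eq: "(\<integral>x. h x t \<partial>lborel) = indicator {0..2 * pi} t *\<^sub>R m t" for t
    unfolding m_def Ap_mass_lborel[OF \<Omega> p hol] set_lebesgue_integral_def
    by (simp add: h_def indicator_def)
  show "set_integrable lborel {0..2 * pi} m"
    using lborel_pair.integrable_snd[OF h_int] unfolding m_eq set_integrable_def .
  have eq: "(LINT t:{0..2 * pi}|lborel. m t) = (\<integral>x. (\<integral>t. h x t \<partial>lborel) \<partial>lborel)"
    unfolding set_lebesgue_integral_def m_eq[symmetric] by (rule lborel_pair.Fubini_integral[OF h_int])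
  assume B: "set_integrable lborel \<Omega> B" and le: "\<And>x. x \<in> \<Omega> \<Longrightarrow>
        (LINT t:{0..2 * pi}|lborel. norm (f x + cis (- t) * g x) powr p) \<le> 2 * pi * B x"
  have "(\<integral>x. (\<integral>t. h x t \<partial>lborel) \<partial>lborel) \<le> (\<integral>x. 2 * pi * (indicator \<Omega> x *\<^sub>R B x) \<partial>lborel)"
  proof (rule integral_mono)
    show "integrable lborel (\<lambda>x. \<integral>t. h x t \<partial>lborel)"
      using int_x h_nonneg by simp
    show "integrable lborel (\<lambda>x. 2 * pi * (indicator \<Omega> x *\<^sub>R B x))"
      using B unfolding set_integrable_def by (rule integrable_mult_right)
    show "(\<integral>t. h x t \<partial>lborel) \<le> 2 * pi * (indicator \<Omega> x *\<^sub>R B x)" for x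
      using le[of x] by (cases "x \<in> \<Omega>") (simp_all add: h_def set_lebesgue_integral_def)
  qed
  also have "\<dots> = 2 * pi * (LINT x:\<Omega>|lborel. B x)"
    by (simp add: set_lebesgue_integral_def)
  finally show "(LINT t:{0..2 * pi}|lborel. m t) \<le> 2 * pi * (LINT x:\<Omega>|lborel. B x)"
    by (simp add: eq)
qed

text \<open>
  As \<open>H\<close> stays in the right half plane, \<open>ln |H|\<close> is the real part of the holomorphic function \<open>Ln H\<close>.
\<close>

lemma circle_mean_ln_norm:
  assumes H: "H holomorphic_on cball 0 r" and r: "r > 0"
    and near: "\<And>l. l \<in> cball 0 r \<Longrightarrow> norm (H l - 1) \<le> 1 / 2"
  shows "set_integrable lborel {0..2 * pi} (\<lambda>t. ln (norm (H (of_real r * cis t))))"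
    and "(LINT t:{0..2 * pi}|lborel. ln (norm (H (of_real r * cis t)))) = 2 * pi * ln (norm (H 0))"
proof -
  have Re: "Re (H l) > 0" if "l \<in> cball 0 r" for l
    using near[OF that] abs_Re_le_cmod[of "H l - 1"] by simp
  have G: "(\<lambda>l. Ln (H l)) holomorphic_on cball 0 r"
    using Re by (intro holomorphic_intros H) (force simp: complex_nonpos_Reals_iff)
  have eq: "ln (norm (H l)) = Re (Ln (H l))" if "l \<in> cball 0 r" for l
    using Re[OF that] by (subst Re_Ln) auto
  have circ: "of_real r * cis t \<in> cball 0 r" for t
    using r by (simp add: norm_mult)
  note mv = circle_mean_value[OF G r]
  show "set_integrable lborel {0..2 * pi} (\<lambda>t. ln (norm (H (of_real r * cis t))))"
    using integrable_Re[OF mv(1)[unfolded set_integrable_def]]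
    by (simp add: set_integrable_def eq[OF circ])
  have "(LINT t:{0..2 * pi}|lborel. Re (Ln (H (of_real r * cis t))))
      = Re (LINT t:{0..2 * pi}|lborel. Ln (H (of_real r * cis t)))"
    using integral_Re[OF mv(1)[unfolded set_integrable_def]]
    by (simp add: set_lebesgue_integral_def)
  then show "(LINT t:{0..2 * pi}|lborel. ln (norm (H (of_real r * cis t)))) = 2 * pi * ln (norm (H 0))"
    using r by (simp add: eq[OF circ] eq mv(2))
qed

lemma Schwarz_Lemma_scaled:
  assumes G: "G holomorphic_on ball 0 R" and G0: "G 0 = 0"
    and bnd: "\<And>l. l \<in> ball 0 R \<Longrightarrow> norm (G l) \<le> B" and B: "B > 0" and l: "l \<in> ball 0 R"
  shows "norm (G l) \<le> 2 * B / R * norm l"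
proof -
  have R: "R > 0" using l by (auto intro: le_less_trans[OF norm_ge_zero])
  define g where "g u = G (of_real R * u) / of_real (2 * B)" for u
  have mem: "of_real R * u \<in> ball 0 R" if "norm u < 1" for u :: complex
    using R that by (simp add: norm_mult)
  have g0: "g 0 = 0" using G0 by (simp add: g_def)
  have "g holomorphic_on ball 0 1"
    unfolding g_def using mem B
    by (intro holomorphic_intros holomorphic_on_compose_gen[OF _ G, unfolded o_def]) auto
  moreover have "norm (g u) < 1" if "norm u < 1" for u
    using bnd[OF mem[OF that]] B by (simp add: g_def norm_divide norm_mult)
  moreover have "norm (l / of_real R) < 1" using l R by (simp add: norm_divide)
  ultimately have "norm (g (l / of_real R)) \<le> norm (l / of_real R)"
    using g0 by (intro Schwarz_Lemma(1)) auto
  then show ?thesis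
    using R B by (simp add: g_def norm_divide norm_mult field_simps)
qed

text \<open>
  Since \<open>\<Psi>\<close> vanishes at 0, the rotating perturbation \<open>cis (- t) * r * \<Psi> l\<close> agrees on the circle \<open>|l| = r\<close> with the
  holomorphic function \<open>r\<^sup>2 * \<Psi> l / l\<close>, whose value at 0 is \<open>r\<^sup>2 * b\<close>. So the mean of the logarithm is known
  exactly. The smallness condition on \<open>r\<close> involves only \<open>B\<close>, \<open>R\<close> and \<open>b\<close>, so one \<open>r\<close> serves all functions
  with these data.
\<close>

lemma circle_mean_ln_perturbed:
  assumes F: "F holomorphic_on ball 0 R" and \<Psi>: "\<Psi> holomorphic_on ball 0 R"
    and at_0: "F 0 = 1" "\<Psi> 0 = 0" and b: "deriv \<Psi> 0 = b" and B: "B \<ge> 1"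
    and bnd: "\<And>l. l \<in> ball 0 R \<Longrightarrow> norm (F l) \<le> B" "\<And>l. l \<in> ball 0 R \<Longrightarrow> norm (\<Psi> l) \<le> B"
    and r: "0 < r" "r < R" "r \<le> 1" "r * (4 * B / R + norm b) \<le> 1 / 4"
  defines "g \<equiv> \<lambda>t. F (of_real r * cis t) + cis (- t) * (of_real r * \<Psi> (of_real r * cis t))"
  shows "g t \<noteq> 0" and "set_integrable lborel {0..2 * pi} (\<lambda>t. ln (norm (g t)))"
    and "(LINT t:{0..2 * pi}|lborel. ln (norm (g t))) = 2 * pi * ln (norm (1 + of_real (r\<^sup>2) * b))"
proof -
  obtain k where k: "k holomorphic_on ball 0 R" "\<And>l. norm l < R \<Longrightarrow> \<Psi> l = l * k l" "deriv \<Psi> 0 = k 0"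
    using Schwarz3[OF \<Psi> at_0(2)] by blast
  \<comment> \<open>On the circle \<open>|l| = r\<close> one has \<open>r / l = cis (- t)\<close>, so \<open>r\<^sup>2 * k l = r\<^sup>2 * \<Psi> l / l\<close> is the rotated perturbation.\<close>
  define H where "H l = F l + of_real (r\<^sup>2) * k l" for l
  have sub: "cball 0 r \<subseteq> ball (0::complex) R" using r by auto
  have H: "H holomorphic_on cball 0 r"
    unfolding H_def using F k(1) sub
    by (intro holomorphic_intros) (auto intro: holomorphic_on_subset)
  have R: "R > 0" using r by simp
  have near: "norm (H l - 1) \<le> 1 / 2" if l: "l \<in> cball 0 r" for l
  proof -
    have l': "l \<in> ball 0 R" using l sub by blast
    have "norm (F l - 1) \<le> 2 * (2 * B) / R * norm l"
    proof (rule Schwarz_Lemma_scaled[OF _ _ _ _ l'])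
      show "(\<lambda>l. F l - 1) holomorphic_on ball 0 R" by (intro holomorphic_intros F)
      show "norm (F u - 1) \<le> 2 * B" if "u \<in> ball 0 R" for u
        using bnd(1)[OF that] B norm_triangle_ineq4[of "F u" 1] by simp
    qed (use at_0 B in auto)
    also have "\<dots> \<le> 4 * B / R * r"
      using l B R mult_left_mono[of "norm l" r "4 * B / R"] by simp
    finally have 1: "norm (F l - 1) \<le> 4 * B / R * r" .
    have "norm (k l) \<le> 4 * B / R + norm b"
    proof (cases "l = 0")
      case True
      then show ?thesis using k(3) b B R by simp
    next
      case False
      have "norm (k l) * norm l \<le> 2 * B / R * norm l"
        using Schwarz_Lemma_scaled[OF \<Psi> at_0(2) bnd(2) _ l'] k(2)[of l] l' B
        by (simp add: norm_mult mult.commute[of "norm (k l)"])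
      then have "norm (k l) \<le> 2 * B / R"
        by (rule mult_right_le_imp_le) (use False in simp)
      also have "\<dots> \<le> 4 * B / R" using B R by (simp add: divide_right_mono)
      finally show ?thesis by (simp add: add_increasing2)
    qed
    then have "norm (of_real (r\<^sup>2) * k l) \<le> r\<^sup>2 * (4 * B / R + norm b)"
      by (simp add: norm_mult norm_power mult_left_mono)
    also have "\<dots> \<le> r * (4 * B / R + norm b)"
      using r B R by (intro mult_right_mono) (auto simp: power2_eq_square mult_left_le)
    finally have 2: "norm (of_real (r\<^sup>2) * k l) \<le> r * (4 * B / R + norm b)" .
    have "norm (H l - 1) \<le> norm (F l - 1) + norm (of_real (r\<^sup>2) * k l)"
      using norm_triangle_ineq[of "F l - 1" "of_real (r\<^sup>2) * k l"] by (simp add: H_def algebra_simps)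
    also have "\<dots> \<le> 4 * B / R * r + r * (4 * B / R + norm b)"
      using 1 2 by simp
    also have "\<dots> \<le> r * (4 * B / R + norm b) + r * (4 * B / R + norm b)"
      using r by (simp add: algebra_simps)
    also have "\<dots> \<le> 1 / 4 + 1 / 4"
      by (intro add_mono r(4))
    finally show ?thesis by simp
  qed
  have g: "g t = H (of_real r * cis t)" for t
  proof -
    have "\<Psi> (of_real r * cis t) = of_real r * cis t * k (of_real r * cis t)"
      using r by (intro k(2)) (simp add: norm_mult)
    moreover have "cis (- t) * cis t = 1" by (simp add: cis_mult)
    then have "cis (- t) * (cis t * u) = u" for u by (simp flip: mult.assoc)
    ultimately show ?thesis
      by (simp add: g_def H_def power2_eq_square mult_ac)
  qed
  have "H (of_real r * cis t) \<noteq> 0"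
    using near[of "of_real r * cis t"] r by (auto simp: norm_mult)
  then show "g t \<noteq> 0" by (simp add: g)
  show "set_integrable lborel {0..2 * pi} (\<lambda>t. ln (norm (g t)))"
    unfolding g using H r(1) near by (rule circle_mean_ln_norm)
  show "(LINT t:{0..2 * pi}|lborel. ln (norm (g t))) = 2 * pi * ln (norm (1 + of_real (r\<^sup>2) * b))"
    unfolding g using circle_mean_ln_norm(2)[OF H r(1) near] at_0(1) k(3) b by (simp add: H_def)
qed

section \<open>The lower bound for the Levi form\<close>

text \<open>
  The competitor for \<open>K_p\<close> at \<open>z + (r * cis t) *s X\<close> is \<open>f + cis (- t) * r * \<psi>\<close>, with the phase chosen against the
  direction of the point. Its value there contributes \<open>p * ln |1 + r\<^sup>2 * b|\<close> to the circle mean of \<open>ln K_p\<close>, that is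
  \<open>p * Re b\<close> after division by \<open>r\<^sup>2\<close>, while its mass costs \<open>\<kappa>\<close> on average. The functions may depend on \<open>r\<close>, as long
  as their masses stay bounded.
\<close>

lemma levi_form_ln_K_p_ge:
  fixes \<Omega> :: "(complex ^ 'n) set" and z X :: "complex ^ 'n"
  assumes \<Omega>: "open \<Omega>" "bounded \<Omega>" and p: "p > 0" and z: "z \<in> \<Omega>"
    and family: "\<And>e. e > 0 \<Longrightarrow> eventually (\<lambda>r. \<exists>f \<psi>. f \<in> Ap p \<Omega> \<and> \<psi> \<in> Ap p \<Omega>
      \<and> f z = 1 \<and> \<psi> z = 0 \<and> vec_deriv X \<psi> z = b \<and> Ap_mass p \<Omega> f \<le> M \<and> Ap_mass p \<Omega> \<psi> \<le> M
      \<and> (LINT t:{0..2 * pi}|lborel. Ap_mass p \<Omega> (\<lambda>x. f x + cis (- t) * (of_real r * \<psi> x)))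
          \<le> 2 * pi * (m_p p \<Omega> z powr p * (1 + r\<^sup>2 * (\<kappa> + e)))) (at_right 0)"
  shows "ereal (p * Re b - \<kappa>) \<le> levi_form (\<lambda>w. ln (K_p p \<Omega> w)) z X"
proof (rule ereal_le_epsilon2)
  fix e' :: real assume "0 < e'"
  \<comment> \<open>One half of \<open>e'\<close> pays for the error in the family, the other for the Taylor expansion of the logarithm.\<close>
  define e where "e = e' / 2"
  have e: "e > 0" using \<open>0 < e'\<close> by (simp add: e_def)
  define N where "N = m_p p \<Omega> z powr p"
  have N: "N > 0" using m_p_pos[OF \<Omega> p z] by (simp add: N_def)
  have lnKz: "ln (K_p p \<Omega> z) = - ln N"
    using m_p_pos[OF \<Omega> p z] by (simp add: ln_K_p[OF \<Omega> p z] N_def ln_powr)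
  obtain \<rho>' where "\<rho>' > 0" "cball z \<rho>' \<subseteq> \<Omega>"
    using \<Omega>(1) z by (meson open_contains_cball)
  then obtain \<rho> where \<rho>: "\<rho> > 0" "cball z (2 * \<rho>) \<subseteq> \<Omega>"
    using that[of "\<rho>' / 2"] by auto
  have sub: "cball w \<rho> \<subseteq> \<Omega>" if "w \<in> cball z \<rho>" for w
  proof -
    have "cball w \<rho> \<subseteq> cball z (2 * \<rho>)"
      using that by (simp add: cball_subset_cball_iff dist_commute)
    then show ?thesis using \<rho>(2) by blast
  qed
  \<comment> \<open>The members of the family depend on \<open>r\<close>, so they need bounds near \<open>z\<close> that are uniform in \<open>r\<close>.\<close>
  obtain A where A: "A > 0"
    "\<And>f w. f \<in> Ap p \<Omega> \<Longrightarrow> cball w \<rho> \<subseteq> \<Omega> \<Longrightarrow> norm (f w) powr p \<le> A * Ap_mass p \<Omega> f"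
    using Ap_point_evaluation[OF \<Omega>(1) p \<rho>(1)] by blast
  define B where "B = max 1 ((A * M) powr (1 / p))"
  have bound: "norm (f w) \<le> B" if "f \<in> Ap p \<Omega>" "Ap_mass p \<Omega> f \<le> M" "w \<in> cball z \<rho>" for f w
  proof -
    have "norm (f w) powr p \<le> A * Ap_mass p \<Omega> f" by (rule A(2)[OF that(1) sub[OF that(3)]])
    also have "\<dots> \<le> A * M" using A(1) that(2) by simp
    finally have "(norm (f w) powr p) powr (1 / p) \<le> (A * M) powr (1 / p)"
      using p by (intro powr_mono2) auto
    then show ?thesis using p by (simp add: powr_powr B_def)
  qed
  define R where "R = \<rho> / (norm X + 1)"
  have R: "R > 0" using \<rho>(1) by (simp add: R_def add_nonneg_pos)
  have line: "z + l *s X \<in> cball z \<rho>" if "l \<in> ball 0 R" for l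
  proof -
    have "norm l * norm X \<le> R * (norm X + 1)" using that R by (intro mult_mono) auto
    also have "\<dots> = \<rho>" using norm_ge_zero[of X] by (simp add: R_def add_nonneg_eq_0_iff)
    finally show ?thesis by (simp add: dist_norm norm_vector_smult)
  qed
  have line_\<Omega>: "z + l *s X \<in> \<Omega>" if "l \<in> ball 0 R" for l
    using sub[OF line[OF that]] \<rho>(1) by auto
  define L where "L = 4 * B / R + norm b"
  have "B \<ge> 1" by (simp add: B_def)
  have L: "L > 0" using R \<open>B \<ge> 1\<close> by (simp add: L_def add_pos_nonneg)
  define \<beta> where "\<beta> = Re b"
  have "((\<lambda>r. ln (1 + r\<^sup>2 * \<beta>) / r\<^sup>2) \<longlongrightarrow> \<beta>) (at_right 0)"
    by real_asymp
  then have ev_ln: "eventually (\<lambda>r. \<beta> - e / p < ln (1 + r\<^sup>2 * \<beta>) / r\<^sup>2) (at_right 0)"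
    using e p by (intro order_tendstoD(1)) auto
  have "((\<lambda>r. 1 + r\<^sup>2 * \<beta>) \<longlongrightarrow> 1) (at_right 0)"
    by real_asymp
  then have ev_pos: "eventually (\<lambda>r. 0 < 1 + r\<^sup>2 * \<beta>) (at_right 0)"
    by (intro order_tendstoD(1)) auto
  have ev_small: "eventually (\<lambda>r. 0 < r \<and> r < min R (min 1 (1 / (4 * L)))) (at_right 0)"
    using R L by (intro eventually_conj eventually_at_right_less eventually_at_rightI[of 0 "min R (min 1 (1 / (4 * L)))"]) auto
  have "eventually (\<lambda>r. ereal (p * Re b - \<kappa> - e') \<le> ereal
      (1 / r\<^sup>2 * (1 / (2 * pi) * (LINT t:{0..2 * pi}|lborel. ln (K_p p \<Omega> (z + (of_real r * cis t) *s X)))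
        - ln (K_p p \<Omega> z)))) (at_right 0)"
    using family[OF e] ev_ln ev_pos ev_small
  proof eventually_elim
    case (elim r)
    then obtain f \<psi> where f: "f \<in> Ap p \<Omega>" "f z = 1" "Ap_mass p \<Omega> f \<le> M"
      and \<psi>: "\<psi> \<in> Ap p \<Omega>" "\<psi> z = 0" "vec_deriv X \<psi> z = b" "Ap_mass p \<Omega> \<psi> \<le> M"
      and mean: "(LINT t:{0..2 * pi}|lborel. Ap_mass p \<Omega> (\<lambda>x. f x + cis (- t) * (of_real r * \<psi> x)))
          \<le> 2 * pi * (N * (1 + r\<^sup>2 * (\<kappa> + e)))"
      unfolding N_def by blast
    have r: "0 < r" "r < R" "r \<le> 1" "r < 1 / (4 * L)" using elim(4) by auto
    have rL: "r * (4 * B / R + norm b) \<le> 1 / 4"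
      using r(4) L unfolding L_def [symmetric] by (simp add: field_simps)
    define w where "w t = z + (of_real r * cis t) *s X" for t
    have circ: "of_real r * cis t \<in> ball 0 R" for t
      using r by (simp add: norm_mult)
    have w: "w t \<in> \<Omega>" and w_sub: "cball (w t) \<rho> \<subseteq> \<Omega>" for t
      unfolding w_def using line_\<Omega>[OF circ] sub[OF line[OF circ]] by auto
    define g where "g t = (\<lambda>x. f x + cis (- t) * (of_real r * \<psi> x))" for t
    define I where "I t = Ap_mass p \<Omega> (g t)" for t
    have r\<psi>: "(\<lambda>x. of_real r * \<psi> x) \<in> Ap p \<Omega>" by (rule Ap_smult(1)[OF \<Omega>(1) p \<psi>(1)])
    have g: "g t \<in> Ap p \<Omega>" for t
      unfolding g_def by (intro Ap_add Ap_smult(1) \<Omega>(1) p f(1) r\<psi>)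
    define F where "F l = f (z + l *s X)" for l
    define \<Psi> where "\<Psi> l = \<psi> (z + l *s X)" for l
    have hol: "F holomorphic_on ball 0 R" "\<Psi> holomorphic_on ball 0 R"
      unfolding F_def \<Psi>_def using line_\<Omega> f(1) \<psi>(1)
      by (auto intro!: holomorphic_on_line dest: Ap_holomorphic)
    have at0: "F 0 = 1" "\<Psi> 0 = 0" "deriv \<Psi> 0 = b"
      using f(2) \<psi>(2) \<psi>(3) vec_deriv_eq_deriv_line[OF Ap_holomorphic[OF \<psi>(1)] z, of X]
      by (simp_all add: F_def \<Psi>_def[abs_def])
    have bnd: "norm (F l) \<le> B" "norm (\<Psi> l) \<le> B" if "l \<in> ball 0 R" for l
      unfolding F_def \<Psi>_def using bound line[OF that] f \<psi> by blast+
    note disc' = circle_mean_ln_perturbed[OF hol at0 \<open>B \<ge> 1\<close> bnd r(1-3) rL]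
    have g_w: "F (of_real r * cis t) + cis (- t) * (of_real r * \<Psi> (of_real r * cis t)) = g t (w t)" for t
      by (simp add: F_def \<Psi>_def g_def w_def)
    have disc: "g t (w t) \<noteq> 0" "set_integrable lborel {0..2 * pi} (\<lambda>t. ln (norm (g t (w t))))"
      "(LINT t:{0..2 * pi}|lborel. ln (norm (g t (w t)))) = 2 * pi * ln (norm (1 + of_real (r\<^sup>2) * b))" for t
      using disc'[unfolded g_w] by blast+
    have I: "set_integrable lborel {0..2 * pi} I"
      unfolding I_def g_def by (rule Ap_mass_rotating_combination(1)[OF \<Omega>(1) p f(1) r\<psi>])
    have lower: "p * ln (norm (g t (w t))) - ln N + 1 - I t / N \<le> ln (K_p p \<Omega> (w t))" for t
    proof -
      have pos: "I t > 0"
        unfolding I_def by (rule Ap_mass_pos[OF \<Omega> p w g disc(1)])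
      \<comment> \<open>Linearising the logarithm at \<open>N\<close> leaves only the circle mean of the masses to be estimated.\<close>
      have "ln (I t / N) \<le> I t / N - 1"
        using pos N by (intro ln_le_minus_one) auto
      then have "ln (I t) \<le> ln N + (I t / N - 1)"
        using pos N by (simp add: ln_div)
      moreover have "p * ln (norm (g t (w t))) - ln (I t) \<le> ln (K_p p \<Omega> (w t))"
        unfolding I_def by (rule ln_K_p_ge[OF \<Omega> p w g disc(1)])
      ultimately show ?thesis by linarith
    qed
    have "2 * pi * (p * ln (norm (1 + of_real (r\<^sup>2) * b)) - ln N + 1) - (LINT t:{0..2 * pi}|lborel. I t) / N
        = (LINT t:{0..2 * pi}|lborel. p * ln (norm (g t (w t))) + (- ln N + 1) - I t / N)"
    proof -
      have "(LINT t:{0..2 * pi}|lborel. p * ln (norm (g t (w t))) + (- ln N + 1) - I t / N)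
          = (LINT t:{0..2 * pi}|lborel. p * ln (norm (g t (w t)))) + (LINT t:{0..2 * pi}|lborel. - ln N + 1)
            - (LINT t:{0..2 * pi}|lborel. I t / N)"
        using disc(2) I by (simp only: set_integral_diff(2) set_integral_add set_integrable_mult_right
            set_integrable_divide set_integrable_Icc_continuous[OF continuous_on_const])
      also have "(LINT t:{0..2 * pi}|lborel. - ln N + 1) = 2 * pi * (- ln N + 1)"
        by (simp add: set_lebesgue_integral_def)
      also have "(LINT t:{0..2 * pi}|lborel. p * ln (norm (g t (w t))))
          = p * (2 * pi * ln (norm (1 + of_real (r\<^sup>2) * b)))"
        unfolding set_integral_mult_right disc(3) ..
      finally show ?thesis
        by (simp add: algebra_simps)
    qed
    also have "\<dots> \<le> (LINT t:{0..2 * pi}|lborel. ln (K_p p \<Omega> (w t)))"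
    proof (rule set_integral_mono)
      show "set_integrable lborel {0..2 * pi} (\<lambda>t. p * ln (norm (g t (w t))) + (- ln N + 1) - I t / N)"
        using disc(2) I by (intro set_integral_diff set_integral_add set_integrable_mult_right
            set_integrable_divide set_integrable_Icc_continuous[OF continuous_on_const])
      show "set_integrable lborel {0..2 * pi} (\<lambda>t. ln (K_p p \<Omega> (w t)))"
        by (rule ln_K_p_circle_integrable[OF \<Omega> p _ \<rho>(1) w_sub])
           (auto simp: w_def intro!: continuous_intros)
      show "p * ln (norm (g t (w t))) + (- ln N + 1) - I t / N \<le> ln (K_p p \<Omega> (w t))" for t
        using lower[of t] by simp
    qed
    finally have main: "2 * pi * (p * ln (norm (1 + of_real (r\<^sup>2) * b)) - ln N + 1) - (LINT t:{0..2 * pi}|lborel. I t) / N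
        \<le> (LINT t:{0..2 * pi}|lborel. ln (K_p p \<Omega> (w t)))" .
    have "(LINT t:{0..2 * pi}|lborel. I t) / N \<le> 2 * pi * (1 + r\<^sup>2 * (\<kappa> + e))"
      using mean N by (simp add: I_def g_def field_simps)
    with main have "2 * pi * (p * ln (norm (1 + of_real (r\<^sup>2) * b)) - ln N - r\<^sup>2 * (\<kappa> + e))
        \<le> (LINT t:{0..2 * pi}|lborel. ln (K_p p \<Omega> (w t)))"
      by (simp add: algebra_simps)
    then have "1 / (2 * pi) * (2 * pi * (p * ln (norm (1 + of_real (r\<^sup>2) * b)) - ln N - r\<^sup>2 * (\<kappa> + e)))
        \<le> 1 / (2 * pi) * (LINT t:{0..2 * pi}|lborel. ln (K_p p \<Omega> (w t)))"
      by (intro mult_left_mono) auto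
    then have avg: "p * ln (norm (1 + of_real (r\<^sup>2) * b)) - r\<^sup>2 * (\<kappa> + e)
        \<le> 1 / (2 * pi) * (LINT t:{0..2 * pi}|lborel. ln (K_p p \<Omega> (w t))) - ln (K_p p \<Omega> z)"
      by (simp add: lnKz)
    have "(\<beta> - e / p) * r\<^sup>2 < ln (1 + r\<^sup>2 * \<beta>)"
      using elim(2) r(1) by (simp add: pos_less_divide_eq)
    also have "ln (1 + r\<^sup>2 * \<beta>) \<le> ln (norm (1 + of_real (r\<^sup>2) * b))"
    proof -
      have "1 + r\<^sup>2 * \<beta> \<le> norm (1 + of_real (r\<^sup>2) * b)"
        using complex_Re_le_cmod[of "1 + of_real (r\<^sup>2) * b"] by (simp add: \<beta>_def)
      then show ?thesis
        using elim(3) by (subst ln_le_cancel_iff) linarith+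
    qed
    finally have "p * ((\<beta> - e / p) * r\<^sup>2) \<le> p * ln (norm (1 + of_real (r\<^sup>2) * b))"
      using p by simp
    then have "(p * \<beta> - e) * r\<^sup>2 \<le> p * ln (norm (1 + of_real (r\<^sup>2) * b))"
      using p by (simp add: algebra_simps)
    with avg have "(p * Re b - \<kappa> - e') * r\<^sup>2
        \<le> 1 / (2 * pi) * (LINT t:{0..2 * pi}|lborel. ln (K_p p \<Omega> (w t))) - ln (K_p p \<Omega> z)"
      by (simp add: \<beta>_def e_def algebra_simps)
    then have "p * Re b - \<kappa> - e'
        \<le> (1 / (2 * pi) * (LINT t:{0..2 * pi}|lborel. ln (K_p p \<Omega> (w t))) - ln (K_p p \<Omega> z)) / r\<^sup>2"
      using r(1) by (subst pos_le_divide_eq) auto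
    then show ?case by (simp add: w_def)
  qed
  then have "ereal (p * Re b - \<kappa> - e') \<le> levi_form (\<lambda>w. ln (K_p p \<Omega> w)) z X"
    unfolding levi_form_def by (rule Liminf_bounded)
  then have "ereal (p * Re b - \<kappa> - e') + ereal e' \<le> levi_form (\<lambda>w. ln (K_p p \<Omega> w)) z X + ereal e'"
    by (rule add_right_mono)
  then show "ereal (p * Re b - \<kappa>) \<le> levi_form (\<lambda>w. ln (K_p p \<Omega> w)) z X + ereal e'"
    by simp
qed

lemma vec_deriv_mult_vanishing:
  assumes f: "holomorphic_cvec_on f \<Omega>" and g: "holomorphic_cvec_on g \<Omega>" and z: "z \<in> \<Omega>" and g0: "g z = 0"
  shows "vec_deriv X (\<lambda>x. f x * g x) z = f z * vec_deriv X g z"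
proof -
  obtain D E where D: "(f has_derivative D) (at z)" "\<And>c v. D (c *s v) = c * D v"
    and E: "(g has_derivative E) (at z)" "\<And>c v. E (c *s v) = c * E v"
    using f g z unfolding holomorphic_cvec_on_def by meson
  have "((\<lambda>l. f (z + l *s X)) has_field_derivative D X) (at 0)"
    using D by (intro has_field_derivative_along_line) auto
  moreover have dg: "((\<lambda>l. g (z + l *s X)) has_field_derivative E X) (at 0)"
    using E by (intro has_field_derivative_along_line) auto
  ultimately have "((\<lambda>l. f (z + l *s X) * g (z + l *s X)) has_field_derivative
      D X * g (z + 0 *s X) + E X * f (z + 0 *s X)) (at 0)"
    by (rule DERIV_mult)
  then have "deriv (\<lambda>l. f (z + l *s X) * g (z + l *s X)) 0 = f z * E X"
    using g0 by (simp add: DERIV_imp_deriv mult.commute)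
  moreover have "vec_deriv X g z = E X"
    using vec_deriv_eq_deriv_line[OF g z] DERIV_imp_deriv[OF dg] by simp
  ultimately show ?thesis
    using vec_deriv_eq_deriv_line[OF holomorphic_cvec_on_mult[OF f g] z] by simp
qed

text \<open>
  The perturbation is \<open>\<psi> = f * a * h\<close> with a near-minimiser \<open>f\<close>. Since \<open>|h| \<le> 1\<close>, the competitor is
  \<open>f * (1 + O(r))\<close> uniformly on \<open>\<Omega>\<close>, and the expansion of the circle mean multiplies the mass by at most
  \<open>1 + p\<^sup>2 / 4 * |a|\<^sup>2 * r\<^sup>2\<close> up to \<open>o(r\<^sup>2)\<close>.
\<close>

lemma norm_square_le_levi_form_bounded:
  fixes \<Omega> :: "(complex ^ 'n) set" and z X :: "complex ^ 'n"
  assumes \<Omega>: "open \<Omega>" "bounded \<Omega>" and p: "p > 0" and z: "z \<in> \<Omega>"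
    and h: "holomorphic_cvec_on h \<Omega>" "h z = 0" "\<And>x. x \<in> \<Omega> \<Longrightarrow> norm (h x) \<le> 1"
  shows "ereal ((norm (vec_deriv X h z))\<^sup>2) \<le> levi_form (\<lambda>w. ln (K_p p \<Omega> w)) z X"
proof -
  define c where "c = vec_deriv X h z"
  \<comment> \<open>The real multiple of \<open>cnj c\<close> that maximises \<open>p * Re (a * c) - p\<^sup>2 / 4 * |a|\<^sup>2\<close>.\<close>
  define a where "a = of_real (2 / p) * cnj c"
  define \<kappa> where "\<kappa> = p\<^sup>2 / 4 * (norm a)\<^sup>2"
  define N where "N = m_p p \<Omega> z powr p"
  have N: "N > 0" using m_p_pos[OF \<Omega> p z] by (simp add: N_def)
  have norm_a: "norm a = 2 / p * norm c" using p by (simp add: a_def norm_mult norm_divide)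
  have \<kappa>: "\<kappa> = (norm c)\<^sup>2"
    using p by (simp add: \<kappa>_def norm_a power2_eq_square field_simps)
  have "a * c = of_real (2 / p * (norm c)\<^sup>2)"
    by (simp add: a_def complex_norm_square mult.commute[of "cnj c"] del: of_real_power)
  then have "p * Re (a * c) = p * (2 / p * (norm c)\<^sup>2)" by simp
  also have "\<dots> = 2 * (norm c)\<^sup>2" using p by simp
  finally have ac: "p * Re (a * c) = 2 * (norm c)\<^sup>2" .
  define M where "M = max 1 (norm a powr p) * (N * 2)"
  have "ereal (p * Re (a * c) - \<kappa>) \<le> levi_form (\<lambda>w. ln (K_p p \<Omega> w)) z X"
  proof (rule levi_form_ln_K_p_ge[OF \<Omega> p z, where M = M])
    fix e :: real assume e: "e > 0"
    have "((\<lambda>\<epsilon>. \<epsilon> + (1 + \<epsilon>) * (\<kappa> + \<epsilon> * (norm a)\<^sup>2)) \<longlongrightarrow> \<kappa>) (at_right 0)"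
      by (auto intro!: tendsto_eq_intros)
    then have "eventually (\<lambda>\<epsilon>. \<epsilon> + (1 + \<epsilon>) * (\<kappa> + \<epsilon> * (norm a)\<^sup>2) < \<kappa> + e) (at_right 0)"
      using e by (intro order_tendstoD(2)) auto
    then have "eventually (\<lambda>\<epsilon>. 0 < \<epsilon> \<and> \<epsilon> < 1 \<and> \<epsilon> + (1 + \<epsilon>) * (\<kappa> + \<epsilon> * (norm a)\<^sup>2) < \<kappa> + e) (at_right 0)"
      using eventually_at_right_less[of "0 :: real"] eventually_at_right_real[OF zero_less_one]
      by eventually_elim auto
    then obtain \<epsilon> where \<epsilon>: "0 < \<epsilon>" "\<epsilon> < 1" "\<epsilon> + (1 + \<epsilon>) * (\<kappa> + \<epsilon> * (norm a)\<^sup>2) < \<kappa> + e"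
      using eventually_happens'[OF trivial_limit_at_right_real] by blast
    obtain d where d: "d > 0" "\<And>v :: complex. norm v \<le> d \<Longrightarrow>
      (LINT t:{0..2 * pi}|lborel. norm (1 + cis (- t) * v) powr p) \<le> 2 * pi * (1 + (p\<^sup>2 / 4 + \<epsilon>) * (norm v)\<^sup>2)"
      using circle_mean_powr_le[OF p \<epsilon>(1)] by metis
    have "eventually (\<lambda>r. 0 < r \<and> r < min 1 (d / (norm a + 1))) (at_right 0)"
      using d(1) by (intro eventually_conj eventually_at_right_less
          eventually_at_rightI[of 0 "min 1 (d / (norm a + 1))"]) (auto simp: add_nonneg_pos)
    then show "eventually (\<lambda>r. \<exists>f \<psi>. f \<in> Ap p \<Omega> \<and> \<psi> \<in> Ap p \<Omega>
      \<and> f z = 1 \<and> \<psi> z = 0 \<and> vec_deriv X \<psi> z = a * c \<and> Ap_mass p \<Omega> f \<le> M \<and> Ap_mass p \<Omega> \<psi> \<le> M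
      \<and> (LINT t:{0..2 * pi}|lborel. Ap_mass p \<Omega> (\<lambda>x. f x + cis (- t) * (of_real r * \<psi> x)))
          \<le> 2 * pi * (m_p p \<Omega> z powr p * (1 + r\<^sup>2 * (\<kappa> + e)))) (at_right 0)"
    proof eventually_elim
      case (elim r)
      then have r: "0 < r" "r < 1" "r * (norm a + 1) < d"
        by (auto simp: pos_less_divide_eq add_nonneg_pos)
      have r1: "r\<^sup>2 \<le> 1" using r by (simp add: power_le_one)
      obtain f where f: "f \<in> Ap p \<Omega>" "f z = 1" "Ap_mass p \<Omega> f \<le> N * (1 + r\<^sup>2 * \<epsilon>)"
        using near_minimizer[OF \<Omega> p z, of "r\<^sup>2 * \<epsilon>"] r \<epsilon> unfolding N_def by auto
      have "r\<^sup>2 * \<epsilon> \<le> 1 * 1" using r1 \<epsilon> by (intro mult_mono) auto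
      then have f2: "Ap_mass p \<Omega> f \<le> N * 2"
        using N by (intro order_trans[OF f(3)] mult_left_mono) auto
      define \<psi> where "\<psi> x = f x * (a * h x)" for x
      have ah: "holomorphic_cvec_on (\<lambda>x. a * h x) \<Omega>"
        by (intro holomorphic_cvec_on_mult holomorphic_cvec_on_const h(1))
      have ah_le: "norm (a * h x) \<le> norm a" if "x \<in> \<Omega>" for x
        using h(3)[OF that] by (simp add: norm_mult mult_left_le)
      have \<psi>: "\<psi> \<in> Ap p \<Omega>" "Ap_mass p \<Omega> \<psi> \<le> norm a powr p * Ap_mass p \<Omega> f"
        unfolding \<psi>_def using Ap_mult_bounded[OF \<Omega>(1) p f(1) ah norm_ge_zero ah_le] by auto
      have f_M: "Ap_mass p \<Omega> f \<le> M"
      proof -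
        have "1 * (N * 2) \<le> M" unfolding M_def using N by (intro mult_right_mono) auto
        then show ?thesis using f2 by simp
      qed
      have \<psi>_M: "Ap_mass p \<Omega> \<psi> \<le> M"
        unfolding M_def using f2 by (intro order_trans[OF \<psi>(2)] mult_mono) auto
      have \<psi>_z: "\<psi> z = 0" using h(2) by (simp add: \<psi>_def)
      have "vec_deriv X \<psi> z = f z * vec_deriv X (\<lambda>x. a * h x) z"
        unfolding \<psi>_def using h(2) by (intro vec_deriv_mult_vanishing[OF Ap_holomorphic[OF f(1)] ah z]) simp
      also have "vec_deriv X (\<lambda>x. a * h x) z = a * c"
        unfolding c_def by (intro vec_deriv_mult_vanishing[OF holomorphic_cvec_on_const h(1) z h(2)])
      finally have \<psi>_deriv: "vec_deriv X \<psi> z = a * c" using f(2) by simp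
      define s where "s = (p\<^sup>2 / 4 + \<epsilon>) * (r * norm a)\<^sup>2"
      have pointwise: "(LINT t:{0..2 * pi}|lborel. norm (f x + cis (- t) * (of_real r * \<psi> x)) powr p)
          \<le> 2 * pi * ((1 + s) * norm (f x) powr p)" if x: "x \<in> \<Omega>" for x
      proof -
        let ?v = "of_real r * (a * h x)"
        have v: "norm ?v \<le> r * norm a"
          using r ah_le[OF x] by (simp only: norm_mult norm_of_real) (simp add: mult_left_mono)
        have "norm (f x + cis (- t) * (of_real r * \<psi> x)) powr p = norm (f x) powr p * norm (1 + cis (- t) * ?v) powr p" for t
        proof -
          have "f x + cis (- t) * (of_real r * \<psi> x) = f x * (1 + cis (- t) * ?v)"
            by (simp add: \<psi>_def algebra_simps)
          then show ?thesis by (simp add: norm_mult powr_mult)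
        qed
        then have "(LINT t:{0..2 * pi}|lborel. norm (f x + cis (- t) * (of_real r * \<psi> x)) powr p)
          = norm (f x) powr p * (LINT t:{0..2 * pi}|lborel. norm (1 + cis (- t) * ?v) powr p)"
          by simp
        also have "\<dots> \<le> norm (f x) powr p * (2 * pi * (1 + (p\<^sup>2 / 4 + \<epsilon>) * (norm ?v)\<^sup>2))"
        proof (intro mult_left_mono d(2))
          have "r * norm a \<le> r * (norm a + 1)" using r by simp
          then show "norm ?v \<le> d" using v r(3) by linarith
        qed simp
        also have "\<dots> \<le> norm (f x) powr p * (2 * pi * (1 + s))"
          unfolding s_def using v \<epsilon> by (intro mult_left_mono add_left_mono power_mono) auto
        finally show ?thesis by (simp add: algebra_simps)
      qed
      have B: "set_integrable lborel \<Omega> (\<lambda>x. (1 + s) * norm (f x) powr p)"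
        using f(1) by (intro set_integrable_mult_right) (simp add: Ap_iff_lborel[OF \<Omega>(1) p])
      have "(LINT t:{0..2 * pi}|lborel. Ap_mass p \<Omega> (\<lambda>x. f x + cis (- t) * (of_real r * \<psi> x)))
          \<le> 2 * pi * (LINT x:\<Omega>|lborel. (1 + s) * norm (f x) powr p)"
        by (rule Ap_mass_rotating_combination(2)[OF \<Omega>(1) p f(1) Ap_smult(1)[OF \<Omega>(1) p \<psi>(1)] B pointwise])
      also have "(LINT x:\<Omega>|lborel. (1 + s) * norm (f x) powr p) = (1 + s) * Ap_mass p \<Omega> f"
        by (simp add: Ap_mass_lborel[OF \<Omega>(1) p Ap_holomorphic[OF f(1)]])
      also have "2 * pi * ((1 + s) * Ap_mass p \<Omega> f) \<le> 2 * pi * (N * (1 + r\<^sup>2 * (\<kappa> + e)))"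
      proof (intro mult_left_mono)
        have s: "s = r\<^sup>2 * (\<kappa> + \<epsilon> * (norm a)\<^sup>2)" "s \<ge> 0"
          using \<epsilon> by (simp_all add: s_def \<kappa>_def power_mult_distrib algebra_simps)
        have "(1 + s) * Ap_mass p \<Omega> f \<le> (1 + s) * (N * (1 + r\<^sup>2 * \<epsilon>))"
          using s f(3) by (intro mult_left_mono) auto
        also have "\<dots> = N * (1 + (r\<^sup>2 * \<epsilon> + (1 + r\<^sup>2 * \<epsilon>) * s))"
          by (simp add: algebra_simps)
        also have "\<dots> \<le> N * (1 + r\<^sup>2 * (\<kappa> + e))"
        proof (intro mult_left_mono add_left_mono)
          have "(1 + r\<^sup>2 * \<epsilon>) * s \<le> (1 + \<epsilon>) * s"
            using r1 \<epsilon> s(2) by (intro mult_right_mono add_left_mono) (auto simp: mult_left_le_one_le)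
          then have "r\<^sup>2 * \<epsilon> + (1 + r\<^sup>2 * \<epsilon>) * s \<le> r\<^sup>2 * (\<epsilon> + (1 + \<epsilon>) * (\<kappa> + \<epsilon> * (norm a)\<^sup>2))"
            by (simp add: s(1) algebra_simps)
          also have "\<dots> \<le> r\<^sup>2 * (\<kappa> + e)"
            using \<epsilon>(3) by (intro mult_left_mono) auto
          finally show "r\<^sup>2 * \<epsilon> + (1 + r\<^sup>2 * \<epsilon>) * s \<le> r\<^sup>2 * (\<kappa> + e)" .
        qed (use N in auto)
        finally show "(1 + s) * Ap_mass p \<Omega> f \<le> N * (1 + r\<^sup>2 * (\<kappa> + e))" .
      qed auto
      finally show ?case
        using f(1,2) \<psi>(1) \<psi>_z \<psi>_deriv f_M \<psi>_M unfolding N_def by blast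
    qed
  qed
  then show ?thesis unfolding ac \<kappa> by (simp add: c_def)
qed

text \<open>
  The perturbation is \<open>\<psi> = a * \<phi>\<close>. Here \<open>\<phi> / f\<close> may be unbounded, and \<open>p \<ge> 2\<close> makes the quadratic term
  \<open>|f| powr (p - 2) * |\<phi>|\<^sup>2\<close> integrable; by Hoelder's inequality its integral is at most the power \<open>p - 2\<close> of the norm of \<open>f\<close>, which is
  close to \<open>m powr (p - 2)\<close>.
\<close>

lemma norm_square_le_levi_form_Ap:
  fixes \<Omega> :: "(complex ^ 'n) set" and z X :: "complex ^ 'n"
  assumes \<Omega>: "open \<Omega>" "bounded \<Omega>" and p: "p \<ge> 2" and z: "z \<in> \<Omega>"
    and \<phi>: "\<phi> \<in> Ap p \<Omega>" "\<phi> z = 0" "Ap_mass p \<Omega> \<phi> = 1"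
  shows "ereal ((m_p p \<Omega> z * norm (vec_deriv X \<phi> z))\<^sup>2) \<le> levi_form (\<lambda>w. ln (K_p p \<Omega> w)) z X"
proof -
  have p0: "p > 0" using p by simp
  define c where "c = vec_deriv X \<phi> z"
  define m where "m = m_p p \<Omega> z"
  have m: "m > 0" unfolding m_def by (rule m_p_pos[OF \<Omega> p0 z])
  \<comment> \<open>The real multiple of \<open>cnj c\<close> that maximises \<open>p * Re (a * c) - p\<^sup>2 / 4 * |a|\<^sup>2 / m\<^sup>2\<close>.\<close>
  define a where "a = of_real (2 / p * m\<^sup>2) * cnj c"
  define \<kappa> where "\<kappa> = p\<^sup>2 / 4 * ((norm a)\<^sup>2 / m\<^sup>2)"
  define N where "N = m powr p"
  have N: "N > 0" using m by (simp add: N_def)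
  have N_m: "N powr (1 - 2 / p) = N / m\<^sup>2"
    using m p0 by (simp add: N_def powr_diff powr_powr)
  have norm_a: "norm a = 2 / p * m\<^sup>2 * norm c" using p0 by (simp add: a_def norm_mult norm_power norm_divide)
  have \<kappa>: "\<kappa> = (m * norm c)\<^sup>2"
    using p0 m by (simp add: \<kappa>_def norm_a power2_eq_square field_simps)
  have "a * c = of_real (2 / p * m\<^sup>2 * (norm c)\<^sup>2)"
    by (simp add: a_def complex_norm_square mult.commute[of "cnj c"] del: of_real_power)
  then have "p * Re (a * c) = p * (2 / p * m\<^sup>2 * (norm c)\<^sup>2)" by (simp only: Re_complex_of_real)
  also have "\<dots> = 2 * (m * norm c)\<^sup>2" using p0 by (simp add: power_mult_distrib)
  finally have ac: "p * Re (a * c) = 2 * (m * norm c)\<^sup>2" .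
  obtain u where u: "norm u = 1" "a = of_real (norm a) * u"
  proof (cases "a = 0")
    case False
    show ?thesis by (rule that[of "sgn a"]) (use False in \<open>simp_all add: norm_divide sgn_eq\<close>)
  qed (use that[of 1] in simp)
  define M where "M = max (norm a powr p) (N * 2)"
  have "ereal (p * Re (a * c) - \<kappa>) \<le> levi_form (\<lambda>w. ln (K_p p \<Omega> w)) z X"
  proof (rule levi_form_ln_K_p_ge[OF \<Omega> p0 z, where M = M])
    fix e :: real assume e: "e > 0"
    define G where "G \<epsilon> = \<epsilon> + (norm a)\<^sup>2 * ((p\<^sup>2 / 4 + \<epsilon>) * ((1 + \<epsilon>) / m\<^sup>2) + \<epsilon> / N)" for \<epsilon>
    have "(G \<longlongrightarrow> \<kappa>) (at_right 0)"
      unfolding G_def using N m by (auto intro!: tendsto_eq_intros simp: \<kappa>_def)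
    then have "eventually (\<lambda>\<epsilon>. G \<epsilon> < \<kappa> + e) (at_right 0)"
      using e by (intro order_tendstoD(2)) auto
    then have "eventually (\<lambda>\<epsilon>. 0 < \<epsilon> \<and> \<epsilon> < 1 \<and> G \<epsilon> < \<kappa> + e) (at_right 0)"
      using eventually_at_right_less[of "0 :: real"] eventually_at_right_real[OF zero_less_one]
      by eventually_elim auto
    then obtain \<epsilon> where \<epsilon>: "0 < \<epsilon>" "\<epsilon> < 1" "G \<epsilon> < \<kappa> + e"
      using eventually_happens'[OF trivial_limit_at_right_real] by blast
    obtain d where d: "d > 0" "\<And>(w :: complex) v \<tau>. 0 \<le> \<tau> \<Longrightarrow> \<tau> \<le> d \<Longrightarrow>
      (LINT t:{0..2 * pi}|lborel. norm (w + cis (- t) * (of_real \<tau> * v)) powr p)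
      \<le> 2 * pi * (norm w powr p + \<tau>\<^sup>2 * ((p\<^sup>2 / 4 + \<epsilon>) * (N powr (1 - 2 / p)
        * ((1 - 2 / p) * (norm w powr p / N) + 2 / p * norm v powr p)) + \<epsilon> * norm v powr p))"
      by (rule circle_mean_powr_le_young[OF p \<epsilon>(1) N]) blast
    have "eventually (\<lambda>r. 0 < r \<and> r < min 1 (d / (norm a + 1))) (at_right 0)"
      using d(1) by (intro eventually_conj eventually_at_right_less
          eventually_at_rightI[of 0 "min 1 (d / (norm a + 1))"]) (auto simp: add_nonneg_pos)
    then show "eventually (\<lambda>r. \<exists>f \<psi>. f \<in> Ap p \<Omega> \<and> \<psi> \<in> Ap p \<Omega>
      \<and> f z = 1 \<and> \<psi> z = 0 \<and> vec_deriv X \<psi> z = a * c \<and> Ap_mass p \<Omega> f \<le> M \<and> Ap_mass p \<Omega> \<psi> \<le> M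
      \<and> (LINT t:{0..2 * pi}|lborel. Ap_mass p \<Omega> (\<lambda>x. f x + cis (- t) * (of_real r * \<psi> x)))
          \<le> 2 * pi * (m_p p \<Omega> z powr p * (1 + r\<^sup>2 * (\<kappa> + e)))) (at_right 0)"
    proof eventually_elim
      case (elim r)
      then have r: "0 < r" "r < 1" "r * (norm a + 1) < d"
        by (auto simp: pos_less_divide_eq add_nonneg_pos)
      have r1: "r\<^sup>2 \<le> 1" using r by (simp add: power_le_one)
      obtain f where f: "f \<in> Ap p \<Omega>" "f z = 1" "Ap_mass p \<Omega> f \<le> N * (1 + r\<^sup>2 * \<epsilon>)"
        using near_minimizer[OF \<Omega> p0 z, of "r\<^sup>2 * \<epsilon>"] r \<epsilon> unfolding N_def m_def by auto
      have r\<epsilon>: "r\<^sup>2 * \<epsilon> \<le> \<epsilon>" using r1 \<epsilon> by (simp add: mult_left_le_one_le)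
      have f2: "Ap_mass p \<Omega> f \<le> N * 2"
        using N r\<epsilon> \<epsilon>(2) by (intro order_trans[OF f(3)] mult_left_mono) auto
      define \<psi> where "\<psi> x = a * \<phi> x" for x
      have \<psi>: "\<psi> \<in> Ap p \<Omega>" "Ap_mass p \<Omega> \<psi> = norm a powr p"
        unfolding \<psi>_def using Ap_smult[OF \<Omega>(1) p0 \<phi>(1)] \<phi>(3) by auto
      have \<psi>_z: "\<psi> z = 0" using \<phi>(2) by (simp add: \<psi>_def)
      have \<psi>_deriv: "vec_deriv X \<psi> z = a * c"
        unfolding c_def \<psi>_def
        by (intro vec_deriv_mult_vanishing[OF holomorphic_cvec_on_const Ap_holomorphic[OF \<phi>(1)] z \<phi>(2)])
      define \<tau> where "\<tau> = r * norm a"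
      have \<tau>: "0 \<le> \<tau>" "\<tau> \<le> d"
      proof -
        have "r * norm a \<le> r * (norm a + 1)" using r by simp
        then show "\<tau> \<le> d" using r(3) unfolding \<tau>_def by linarith
      qed (use r in \<open>simp add: \<tau>_def\<close>)
      define B where "B x = norm (f x) powr p + \<tau>\<^sup>2 * ((p\<^sup>2 / 4 + \<epsilon>) * (N powr (1 - 2 / p)
        * ((1 - 2 / p) * (norm (f x) powr p / N) + 2 / p * norm (\<phi> x) powr p)) + \<epsilon> * norm (\<phi> x) powr p)" for x
      have pointwise: "(LINT t:{0..2 * pi}|lborel. norm (f x + cis (- t) * (of_real r * \<psi> x)) powr p)
          \<le> 2 * pi * B x" for x
      proof -
        have "of_real r * \<psi> x = of_real \<tau> * (u * \<phi> x)"
          unfolding \<psi>_def \<tau>_def by (subst u(2)) simp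
        then show ?thesis
          using d(2)[OF \<tau>, of "f x" "u * \<phi> x"] by (simp add: B_def norm_mult u(1))
      qed
      have int: "set_integrable lborel \<Omega> (\<lambda>x. norm (f x) powr p)" "set_integrable lborel \<Omega> (\<lambda>x. norm (\<phi> x) powr p)"
        using f(1) \<phi>(1) by (auto simp: Ap_iff_lborel[OF \<Omega>(1) p0])
      have B_eq: "B = (\<lambda>x. (1 + \<tau>\<^sup>2 * ((p\<^sup>2 / 4 + \<epsilon>) * (N powr (1 - 2 / p) * ((1 - 2 / p) / N)))) * norm (f x) powr p
          + \<tau>\<^sup>2 * ((p\<^sup>2 / 4 + \<epsilon>) * (N powr (1 - 2 / p) * (2 / p)) + \<epsilon>) * norm (\<phi> x) powr p)"
        by (auto simp: B_def fun_eq_iff algebra_simps)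
      have B: "set_integrable lborel \<Omega> B"
        unfolding B_eq by (intro set_integral_add set_integrable_mult_right int)
      have intB: "(LINT x:\<Omega>|lborel. B x)
          = Ap_mass p \<Omega> f + \<tau>\<^sup>2 * ((p\<^sup>2 / 4 + \<epsilon>) * (N / m\<^sup>2 * ((1 - 2 / p) * (Ap_mass p \<Omega> f / N) + 2 / p)) + \<epsilon>)"
      proof -
        have "(LINT x:\<Omega>|lborel. norm (f x) powr p) = Ap_mass p \<Omega> f" "(LINT x:\<Omega>|lborel. norm (\<phi> x) powr p) = 1"
          using \<phi>(3) Ap_mass_lborel[OF \<Omega>(1) p0 Ap_holomorphic] f(1) \<phi>(1) by metis+
        then have "(LINT x:\<Omega>|lborel. \<alpha> * norm (f x) powr p + \<beta> * norm (\<phi> x) powr p)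
            = \<alpha> * Ap_mass p \<Omega> f + \<beta>" for \<alpha> \<beta>
          by (subst set_integral_add(2)) (auto intro!: set_integrable_mult_right int)
        moreover have "(1 + T * (A * (K * (q / N)))) * J + T * (A * (K * w) + \<epsilon>)
            = J + T * (A * (K * (q * (J / N) + w)) + \<epsilon>)" for T A K q J w
          by (simp add: algebra_simps)
        ultimately show ?thesis
          unfolding B_eq N_m by (simp only:)
      qed
      have "(LINT t:{0..2 * pi}|lborel. Ap_mass p \<Omega> (\<lambda>x. f x + cis (- t) * (of_real r * \<psi> x)))
          \<le> 2 * pi * (LINT x:\<Omega>|lborel. B x)"
        by (rule Ap_mass_rotating_combination(2)[OF \<Omega>(1) p0 f(1) Ap_smult(1)[OF \<Omega>(1) p0 \<psi>(1)] B pointwise])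
      also have "\<dots> \<le> 2 * pi * (N * (1 + r\<^sup>2 * (\<kappa> + e)))"
      proof (intro mult_left_mono)
        define J where "J = Ap_mass p \<Omega> f / N"
        have J: "J \<le> 1 + r\<^sup>2 * \<epsilon>" "Ap_mass p \<Omega> f = N * J"
          using f(3) N by (simp_all add: J_def field_simps)
        have "J \<le> 1 + \<epsilon>" using J(1) r\<epsilon> by linarith
        moreover have "2 / p * 1 \<le> 2 / p * (1 + \<epsilon>)"
          using p \<epsilon>(1) by (intro mult_left_mono) auto
        ultimately have "(1 - 2 / p) * J + 2 / p \<le> (1 - 2 / p) * (1 + \<epsilon>) + 2 / p * (1 + \<epsilon>)"
          using p by (intro add_mono mult_left_mono) auto
        also have "\<dots> = 1 + \<epsilon>" by (simp add: algebra_simps)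
        finally have J2: "(1 - 2 / p) * J + 2 / p \<le> 1 + \<epsilon>" .
        have "(LINT x:\<Omega>|lborel. B x)
            = N * (J + \<tau>\<^sup>2 * ((p\<^sup>2 / 4 + \<epsilon>) * (((1 - 2 / p) * J + 2 / p) / m\<^sup>2) + \<epsilon> / N))"
        proof -
          have "N * J + T * (A * (N / m\<^sup>2 * Y) + \<epsilon>) = N * (J + T * (A * (Y / m\<^sup>2) + \<epsilon> / N))" for T A Y
            using N by (simp add: distrib_left mult_ac)
          moreover have "N * J / N = J" using N by simp
          ultimately show ?thesis unfolding intB J(2) by (simp only:)
        qed
        also have "\<dots> \<le> N * ((1 + r\<^sup>2 * \<epsilon>) + \<tau>\<^sup>2 * ((p\<^sup>2 / 4 + \<epsilon>) * ((1 + \<epsilon>) / m\<^sup>2) + \<epsilon> / N))"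
          using N \<epsilon>
          by (intro mult_left_mono add_mono[OF J(1)] add_right_mono divide_right_mono[OF J2]) auto
        also have "\<dots> = N * (1 + r\<^sup>2 * G \<epsilon>)"
          by (simp add: G_def \<tau>_def power_mult_distrib algebra_simps)
        also have "\<dots> \<le> N * (1 + r\<^sup>2 * (\<kappa> + e))"
          using N \<epsilon>(3) by (intro mult_left_mono add_left_mono) auto
        finally show "(LINT x:\<Omega>|lborel. B x) \<le> N * (1 + r\<^sup>2 * (\<kappa> + e))" .
      qed auto
      finally show ?case
        using f(1,2) f2 \<psi> \<psi>_z \<psi>_deriv unfolding N_def m_def M_def by (intro exI[of _ f] exI[of _ \<psi>]) auto
    qed
  qed
  then show ?thesis unfolding ac \<kappa> by (simp add: c_def m_def)
qed

section \<open>Passage to the suprema\<close>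

lemma exists_coordinate_nonzero:
  fixes \<Omega> :: "(complex ^ 'n) set"
    and z :: "complex ^ 'n"
  assumes "open \<Omega>" "z \<in> \<Omega>"
  obtains w :: "complex ^ 'n" where "w \<in> \<Omega>" "w $ j - z $ j \<noteq> 0"
proof -
  obtain R where R: "R > 0" "cball z R \<subseteq> \<Omega>" using assms by (meson open_contains_cball)
  let ?w = "z + R *\<^sub>R axis j 1"
  have "axis j (1 :: complex) \<in> Basis" by (simp add: axis_in_Basis_iff)
  then have "?w \<in> cball z R" using R(1) by (simp add: dist_norm norm_Basis)
  then show ?thesis using that[of ?w] R by (auto simp: axis_def)
qed

text \<open>
  Suprema of the empty set have no meaning in the reals, so the metrics need a competitor: a normalised
  coordinate function centred at \<open>z\<close>.
\<close>

lemma bergman_competitor_exists: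
  fixes \<Omega> :: "(complex ^ 'n) set" and z :: "complex ^ 'n"
  assumes \<Omega>: "open \<Omega>" "bounded \<Omega>" and p: "p > 0" and z: "z \<in> \<Omega>"
  obtains \<phi> where "\<phi> \<in> Ap p \<Omega>" "\<phi> z = 0" "Ap_norm p \<Omega> \<phi> = 1"
proof -
  fix j :: 'n
  define g where "g x = x $ j - z $ j" for x :: "complex ^ 'n"
  obtain w where w: "w \<in> \<Omega>" "g w \<noteq> 0"
    using exists_coordinate_nonzero[OF \<Omega>(1) z, of j] unfolding g_def by blast
  obtain C where C: "\<And>x. x \<in> \<Omega> \<Longrightarrow> norm x \<le> C" using \<Omega>(2) by (auto simp: bounded_iff)
  have gC: "norm (g x) \<le> C + C" if "x \<in> \<Omega>" for x
    using C[OF that] C[OF z] Finite_Cartesian_Product.norm_nth_le[of x j] Finite_Cartesian_Product.norm_nth_le[of z j]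
      norm_triangle_ineq4[of "x $ j" "z $ j"] by (simp add: g_def)
  have "(\<lambda>x. 1 * g x) \<in> Ap p \<Omega>"
    using gC order_trans[OF norm_ge_zero C[OF z]] unfolding g_def
    by (intro Ap_mult_bounded(1)[OF \<Omega>(1) p Ap_const[OF \<Omega> p] holomorphic_cvec_on_coord, of "C + C"]) auto
  then have g: "g \<in> Ap p \<Omega>" by simp
  define S where "S = Ap_norm p \<Omega> g"
  have S: "S > 0" using Ap_mass_pos[OF \<Omega> p w(1) g w(2)] by (simp add: S_def Ap_norm_eq)
  show ?thesis
  proof
    show "(\<lambda>x. of_real (1 / S) * g x) \<in> Ap p \<Omega>" by (rule Ap_smult(1)[OF \<Omega>(1) p g])
    show "of_real (1 / S) * g z = 0" by (simp add: g_def)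
    have "Ap_norm p \<Omega> (\<lambda>x. of_real (1 / S) * g x) = 1 / S * S"
      using S p unfolding Ap_norm_eq Ap_smult(2)[OF \<Omega>(1) p g]
      by (simp add: S_def Ap_norm_eq powr_mult powr_powr norm_divide)
    then show "Ap_norm p \<Omega> (\<lambda>x. of_real (1 / S) * g x) = 1" using S by simp
  qed
qed

lemma caratheodory_competitor_exists:
  fixes \<Omega> :: "(complex ^ 'n) set" and z :: "complex ^ 'n"
  assumes \<Omega>: "open \<Omega>" "bounded \<Omega>" and z: "z \<in> \<Omega>"
  obtains h where "h \<in> Ainf \<Omega>" "h z = 0" "Ainf_norm \<Omega> h = 1"
proof -
  fix j :: 'n
  define g where "g x = x $ j - z $ j" for x :: "complex ^ 'n"
  obtain w where w: "w \<in> \<Omega>" "g w \<noteq> 0"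
    using exists_coordinate_nonzero[OF \<Omega>(1) z, of j] unfolding g_def by blast
  obtain C where C: "\<And>x. x \<in> \<Omega> \<Longrightarrow> norm x \<le> C" using \<Omega>(2) by (auto simp: bounded_iff)
  have gC: "norm (g x) \<le> C + C" if "x \<in> \<Omega>" for x
    using C[OF that] C[OF z] Finite_Cartesian_Product.norm_nth_le[of x j] Finite_Cartesian_Product.norm_nth_le[of z j]
      norm_triangle_ineq4[of "x $ j" "z $ j"] by (simp add: g_def)
  have bdd: "bdd_above ((\<lambda>x. norm (g x)) ` \<Omega>)" using gC by (intro bdd_aboveI[of _ "C + C"]) auto
  define S where "S = Ainf_norm \<Omega> g"
  have le_S: "norm (g x) \<le> S" if "x \<in> \<Omega>" for x
    unfolding S_def Ainf_norm_def by (rule cSUP_upper[OF that bdd])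
  have S: "S > 0" using le_S[OF w(1)] w(2) by (meson less_le_trans zero_less_norm_iff)
  define h where "h x = of_real (1 / S) * g x" for x
  have norm_h: "norm (h x) = norm (g x) / S" for x using S by (simp add: h_def norm_divide)
  have h1: "norm (h x) \<le> 1" if "x \<in> \<Omega>" for x using le_S[OF that] S by (simp add: norm_h)
  show ?thesis
  proof
    have "holomorphic_cvec_on h \<Omega>"
      unfolding h_def g_def
      by (intro holomorphic_cvec_on_mult holomorphic_cvec_on_const holomorphic_cvec_on_coord)
    then show "h \<in> Ainf \<Omega>" using h1 by (auto simp: Ainf_def bounded_iff)
    show "h z = 0" by (simp add: h_def g_def)
    have "S \<le> S * Ainf_norm \<Omega> h"
    proof -
      have "norm (g x) \<le> S * Ainf_norm \<Omega> h" if "x \<in> \<Omega>" for x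
      proof -
        have "norm (h x) \<le> Ainf_norm \<Omega> h"
          unfolding Ainf_norm_def using h1 by (intro cSUP_upper[OF that] bdd_aboveI[of _ 1]) auto
        then show ?thesis using S by (simp add: norm_h field_simps)
      qed
      then show ?thesis
        using z unfolding S_def Ainf_norm_def[of \<Omega> g] by (intro cSUP_least) (auto simp: Ainf_norm_def)
    qed
    then have "1 \<le> Ainf_norm \<Omega> h" using S by simp
    moreover have "Ainf_norm \<Omega> h \<le> 1"
      unfolding Ainf_norm_def using z h1 by (intro cSUP_least) auto
    ultimately show "Ainf_norm \<Omega> h = 1" by simp
  qed
qed

text \<open>
  If \<open>L\<close> is finite, the hypothesis also bounds \<open>S\<close> from above, so that \<open>Sup S\<close> is the true supremum.
\<close>

lemma ereal_square_Sup_le: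
  fixes S :: "real set"
  assumes ne: "S \<noteq> {}" and nn: "\<And>s. s \<in> S \<Longrightarrow> 0 \<le> s" and m: "m > 0"
    and le: "\<And>s. s \<in> S \<Longrightarrow> ereal ((m * s)\<^sup>2) \<le> L"
  shows "ereal ((m * Sup S)\<^sup>2) \<le> L"
proof (cases L)
  case (real l)
  have *: "s \<le> sqrt l / m" if "s \<in> S" for s
  proof -
    have "(m * s)\<^sup>2 \<le> l" using le[OF that] real by simp
    then have "m * s \<le> sqrt l" by (rule real_le_rsqrt)
    then show ?thesis using m by (simp add: field_simps)
  qed
  obtain s where s: "s \<in> S" using ne by blast
  have l: "0 \<le> l" using le[OF s] real by (simp add: order_trans[OF zero_le_power2])
  have "s \<le> Sup S" using * by (intro cSup_upper[OF s] bdd_aboveI)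
  then have "0 \<le> m * Sup S" using nn[OF s] m by simp
  moreover have "Sup S \<le> sqrt l / m" using ne * by (rule cSup_least)
  then have "m * Sup S \<le> sqrt l" using m by (simp add: field_simps)
  ultimately have "(m * Sup S)\<^sup>2 \<le> (sqrt l)\<^sup>2" by (intro power_mono) auto
  then show ?thesis using l real by simp
qed (use ne le in auto)

theorem theorem1p5:
  fixes \<Omega> :: "(complex ^ 'n) set" and p :: real and z X :: "complex ^ 'n"
  assumes "open \<Omega>" and "connected \<Omega>" and "bounded \<Omega>"
    and "p > 0" and "z \<in> \<Omega>"
  shows "(p \<ge> 2 \<longrightarrow> levi_form (\<lambda>w. ln (K_p p \<Omega> w)) z X \<ge> ereal ((bergman_metric p \<Omega> z X)\<^sup>2)) \<and>
         (p \<le> 2 \<longrightarrow> levi_form (\<lambda>w. ln (K_p p \<Omega> w)) z X \<ge> ereal ((caratheodory_metric \<Omega> z X)\<^sup>2))"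
proof (intro conjI impI)
  assume p: "p \<ge> 2"
  let ?S = "{norm (vec_deriv X f z) | f. f \<in> Ap p \<Omega> \<and> f z = 0 \<and> Ap_norm p \<Omega> f = 1}"
  have m: "m_p p \<Omega> z > 0" using assms by (intro m_p_pos)
  have "ereal ((m_p p \<Omega> z * Sup ?S)\<^sup>2) \<le> levi_form (\<lambda>w. ln (K_p p \<Omega> w)) z X"
  proof (rule ereal_square_Sup_le[OF _ _ m])
    show "?S \<noteq> {}" using bergman_competitor_exists[OF assms(1,3,4,5)] by blast
    fix s assume "s \<in> ?S"
    then obtain \<phi> where \<phi>: "s = norm (vec_deriv X \<phi> z)" "\<phi> \<in> Ap p \<Omega>" "\<phi> z = 0" "Ap_norm p \<Omega> \<phi> = 1"
      by blast
    have "Ap_mass p \<Omega> \<phi> = (Ap_mass p \<Omega> \<phi> powr (1 / p)) powr p"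
      using assms(4) by (simp add: powr_powr)
    also have "\<dots> = 1" using \<phi>(4) by (simp add: Ap_norm_eq)
    finally show "ereal ((m_p p \<Omega> z * s)\<^sup>2) \<le> levi_form (\<lambda>w. ln (K_p p \<Omega> w)) z X"
      unfolding \<phi>(1) using assms p \<phi> by (intro norm_square_le_levi_form_Ap)
  qed auto
  moreover have "K_p p \<Omega> z powr (- 1 / p) = m_p p \<Omega> z"
    using m assms(4) by (simp add: K_p_def powr_powr)
  ultimately show "levi_form (\<lambda>w. ln (K_p p \<Omega> w)) z X \<ge> ereal ((bergman_metric p \<Omega> z X)\<^sup>2)"
    by (simp add: bergman_metric_def)
next
  let ?S = "{norm (vec_deriv X f z) | f. f \<in> Ainf \<Omega> \<and> f z = 0 \<and> Ainf_norm \<Omega> f = 1}"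
  have "ereal ((1 * Sup ?S)\<^sup>2) \<le> levi_form (\<lambda>w. ln (K_p p \<Omega> w)) z X"
  proof (rule ereal_square_Sup_le)
    show "?S \<noteq> {}" using caratheodory_competitor_exists[OF assms(1,3,5)] by blast
    fix s assume "s \<in> ?S"
    then obtain h where h: "s = norm (vec_deriv X h z)" "h \<in> Ainf \<Omega>" "h z = 0" "Ainf_norm \<Omega> h = 1"
      by blast
    have "bdd_above ((\<lambda>x. norm (h x)) ` \<Omega>)"
      using h(2) by (auto simp: Ainf_def bounded_iff intro: bdd_aboveI)
    then have "norm (h x) \<le> 1" if "x \<in> \<Omega>" for x
      using cSUP_upper[OF that, of "\<lambda>x. norm (h x)"] h(4) by (simp add: Ainf_norm_def)
    then show "ereal ((1 * s)\<^sup>2) \<le> levi_form (\<lambda>w. ln (K_p p \<Omega> w)) z X"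
      using norm_square_le_levi_form_bounded[OF assms(1,3,4,5), of h X] h by (simp add: Ainf_def)
  qed auto
  then show "levi_form (\<lambda>w. ln (K_p p \<Omega> w)) z X \<ge> ereal ((caratheodory_metric \<Omega> z X)\<^sup>2)"
    by (simp add: caratheodory_metric_def)
qed

end
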